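(* Let $X$ be either $\mathbb{R}^N$ (finite-dimensional case) or $L^2(\Omega)$ (infinite-dimensional case), let $\sigma$ be the corresponding nonnegative interaction matrix or interaction function, and let $A:X\to X$ be the associated interaction operator. Assume that the directed graph associated to $\sigma$ is strongly connected. Then there exists a unique $v\in\ker A^*$ such that $v>0$ and $\langle v,e\rangle=1$. Moreover, for any solution $y:[0,+\infty)\to X$ of the Cauchy problem $\dot y(t)=Ay(t)$, $y(0)=y^{\mathrm{in}}$ (with $y^{\mathrm{in}}\in X$), the weighted mean $\bar y^v=\langle y(t),v\rangle\, e$ is constant with respect to time $t\geq 0$.
   Context: Finite-dimensional case: $X=\mathbb{R}^N$ with the Euclidean scalar product $\langle\cdot,\cdot\rangle$; $\sigma=(\sigma_{ij})\in\mathbb{R}^{N\times N}$ with $\sigma_{ij}\ge 0$; $e=(1,\dots,1)^\intercal$; $A$ is the matrix with $A_{ij}=\sigma_{ij}$ for $i\ne j$ and $A_{ii}=-\sum_{k\neq i}\sigma_{ik}$, i.e. $(Ay)_i=\sum_j\sigma_{ij}(y_j-y_i)$; $A^*$ is the transpose. The directed graph associated to $\sigma$ has vertices $1,\dots,N$ and an edge from $i$ to $j$ when $\sigma_{ij}>0$. It is strongly connected if, for any pair $(i,j)$ with $i\ne j$, there is a sequence of distinct indices $(i_0,\dots,i_r)$, $r\ge1$, with $i_0=i$, $i_r=j$ and $\sigma_{i_ki_{k+1}}>0$ for $0\le k\le r-1$. Here $v>0$ means $v_i>0$ for all $i$. Infinite-dimensional case: $\Omega\subset\mathbb{R}^d$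 ($d\ge1$) is a bounded open set with Lebesgue measure $|\Omega|=1$; $X=L^2(\Omega)$ with its usual scalar product $\langle\cdot,\cdot\rangle$; $\sigma\in L^\infty(\Omega^2)$ is nonnegative, with no symmetry assumed; $e$ is the constant function $1$; $A:L^2(\Omega)\to L^2(\Omega)$ is the bounded operator $(Az)(x)=\int_\Omega\sigma(x,x_* )(z(x_* )-z(x))\,\mathrm{d}x_*$ for a.e. $x\in\Omega$; $A^*$ is its adjoint; $S(x)=\int_\Omega\sigma(x,x_* )\,\mathrm{d}x_*$. The directed graph associated to $\sigma$ has as vertices the Lebesgue points $x\in\Omega$ of $\sigma$, i.e. those such that $x_*\mapsto\sigma(x,x_* )$ is defined almost everywhere in $\Omega$; for vertices $x_1\ne x_2$, $(x_1,x_2)$ is an arc if $x_2$ belongs to the essential support of $\sigma(x_1,\cdot)$. The graph is strongly connected if (1) for any Lebesgue points $x\neq x_*$ there exist pairwise distinct Lebesgue points $x_0,\dots,x_r$, $r\ge1$, with $x_0=x$, $x_r=x_*$ and $x_{k+1}\in\operatorname{ess\,supp}\sigma(x_k,\cdot)$ for $0\le k\le r-1$; and (2) $\delta:=\operatorname{ess\,inf}S>0$. Here $v>0$ means $v>0$ almost everywhere in $\Omega$.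
   Formalization: In the L² case, essential support means the points of positive upper density of the set where σ(x,·) is nonzero (with the topological support the claim fails), and vertices are x such that (x,x_* ) is a Lebesgue point of σ for a.e. x_*, with σ taking its Lebesgue values. *)

theory Defs
  imports "HOL-Analysis.Analysis"
begin

definition strongly_connected :: "'v set \<Rightarrow> ('v \<Rightarrow> 'v \<Rightarrow> bool) \<Rightarrow> bool" where
  "strongly_connected V E \<longleftrightarrow>
     (\<forall>i\<in>V. \<forall>j\<in>V. i \<noteq> j \<longrightarrow>
        (\<exists>r\<ge>1. \<exists>p::nat \<Rightarrow> 'v. p 0 = i \<and> p r = j \<and> inj_on p {0..r} \<and>
           (\<forall>k\<le>r. p k \<in> V) \<and> (\<forall>k<r. E (p k) (p (Suc k)))))"

definition interaction_matrix :: "real^'n^'n \<Rightarrow> real^'n^'n" where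
  "interaction_matrix s =
     (\<chi> i j. if i = j then - (\<Sum>k\<in>UNIV - {i}. s $ i $ k) else s $ i $ j)"

definition ones :: "real^'n" where
  "ones = (\<chi> i. 1)"

definition matrix_graph_strongly_connected :: "real^'n^'n \<Rightarrow> bool" where
  "matrix_graph_strongly_connected s \<longleftrightarrow> strongly_connected UNIV (\<lambda>i j. s $ i $ j > 0)"

definition normalized_kernel_vector :: "real^'n^'n \<Rightarrow> real^'n \<Rightarrow> bool" where
  "normalized_kernel_vector s v \<longleftrightarrow>
     transpose (interaction_matrix s) *v v = 0 \<and> (\<forall>i. v $ i > 0) \<and> v \<bullet> ones = 1"

definition cauchy_solution :: "real^'n^'n \<Rightarrow> real^'n \<Rightarrow> (real \<Rightarrow> real^'n) \<Rightarrow> bool" where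
  "cauchy_solution s yin y \<longleftrightarrow>
     y 0 = yin \<and>
     (\<forall>t\<ge>0. (y has_vector_derivative (interaction_matrix s *v y t)) (at t within {0..}))"

definition weighted_mean :: "real^'n \<Rightarrow> real^'n \<Rightarrow> real^'n" where
  "weighted_mean v z = (z \<bullet> v) *\<^sub>R ones"

text \<open>
  Elements of \<open>L\<^sup>2(\<Omega>)\<close> are given by representatives. Only the restriction to
  \<open>\<Omega>\<close> matters, and equality is equality almost everywhere in \<open>\<Omega>\<close>.
\<close>

definition L2 :: "'a::euclidean_space set \<Rightarrow> ('a \<Rightarrow> real) set" where
  "L2 \<Omega> = {f \<in> borel_measurable (lebesgue_on \<Omega>). integrable (lebesgue_on \<Omega>) (\<lambda>x. (f x)\<^sup>2)}"

definition L2_inner :: "'a::euclidean_space set \<Rightarrow> ('a \<Rightarrow> real) \<Rightarrow> ('a \<Rightarrow> real) \<Rightarrow> real" where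
  "L2_inner \<Omega> f g = (LINT x|lebesgue_on \<Omega>. f x * g x)"

definition L2_norm :: "'a::euclidean_space set \<Rightarrow> ('a \<Rightarrow> real) \<Rightarrow> real" where
  "L2_norm \<Omega> f = sqrt (L2_inner \<Omega> f f)"

text \<open>Analogue of the library's \<^const>\<open>adjoint\<close>; its values are unique up to null sets.\<close>

definition L2_adjoint ::
  "'a::euclidean_space set \<Rightarrow> (('a \<Rightarrow> real) \<Rightarrow> 'a \<Rightarrow> real) \<Rightarrow> ('a \<Rightarrow> real) \<Rightarrow> 'a \<Rightarrow> real" where
  "L2_adjoint \<Omega> T = (SOME T'. \<forall>g\<in>L2 \<Omega>. T' g \<in> L2 \<Omega> \<and>
     (\<forall>f\<in>L2 \<Omega>. L2_inner \<Omega> (T f) g = L2_inner \<Omega> f (T' g)))"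

definition L2_kernel ::
  "'a::euclidean_space set \<Rightarrow> (('a \<Rightarrow> real) \<Rightarrow> 'a \<Rightarrow> real) \<Rightarrow> ('a \<Rightarrow> real) set" where
  "L2_kernel \<Omega> T = {f \<in> L2 \<Omega>. AE x in lebesgue_on \<Omega>. T f x = 0}"

text \<open>Derivative in the norm of \<open>L\<^sup>2(\<Omega>)\<close>; one-sided at time \<open>0\<close>.\<close>

definition L2_has_derivative_at ::
  "'a::euclidean_space set \<Rightarrow> (real \<Rightarrow> 'a \<Rightarrow> real) \<Rightarrow> ('a \<Rightarrow> real) \<Rightarrow> real \<Rightarrow> bool" where
  "L2_has_derivative_at \<Omega> y d t \<longleftrightarrow>
     ((\<lambda>s. L2_norm \<Omega> (\<lambda>x. (y s x - y t x) / (s - t) - d x)) \<longlongrightarrow> 0) (at t within {0..})"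

definition interaction_function :: "'a::euclidean_space set \<Rightarrow> ('a \<times> 'a \<Rightarrow> real) \<Rightarrow> bool" where
  "interaction_function \<Omega> \<sigma> \<longleftrightarrow>
     \<sigma> \<in> borel_measurable (lebesgue_on (\<Omega> \<times> \<Omega>)) \<and>
     (\<exists>M. AE p in lebesgue_on (\<Omega> \<times> \<Omega>). \<bar>\<sigma> p\<bar> \<le> M) \<and>
     (AE p in lebesgue_on (\<Omega> \<times> \<Omega>). 0 \<le> \<sigma> p)"

definition interaction_operator ::
  "'a::euclidean_space set \<Rightarrow> ('a \<times> 'a \<Rightarrow> real) \<Rightarrow> ('a \<Rightarrow> real) \<Rightarrow> 'a \<Rightarrow> real" where
  "interaction_operator \<Omega> \<sigma> z x = (LINT x'|lebesgue_on \<Omega>. \<sigma> (x, x') * (z x' - z x))"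

definition total_interaction ::
  "'a::euclidean_space set \<Rightarrow> ('a \<times> 'a \<Rightarrow> real) \<Rightarrow> 'a \<Rightarrow> real" where
  "total_interaction \<Omega> \<sigma> x = (LINT x'|lebesgue_on \<Omega>. \<sigma> (x, x'))"

definition ess_inf :: "'a measure \<Rightarrow> ('a \<Rightarrow> real) \<Rightarrow> ereal" where
  "ess_inf M f = Sup {c. AE x in M. c \<le> ereal (f x)}"

text \<open>
  A class in \<open>L\<^sup>\<infinity>\<close> has pointwise values only at its Lebesgue points:
  \<open>f\<close> has the value \<open>c\<close> at \<open>p\<close> if the mean of \<open>\<bar>f - c\<bar>\<close> over small balls around \<open>p\<close>
  tends to \<open>0\<close>. This does not depend on the representative.
\<close>

definition has_lebesgue_value ::
  "'b::euclidean_space set \<Rightarrow> ('b \<Rightarrow> real) \<Rightarrow> 'b \<Rightarrow> real \<Rightarrow> bool" where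
  "has_lebesgue_value D f p c \<longleftrightarrow>
     ((\<lambda>r. (LINT q|lebesgue_on (D \<inter> ball p r). \<bar>f q - c\<bar>) / measure lebesgue (D \<inter> ball p r))
        \<longlongrightarrow> 0) (at_right 0)"

definition lebesgue_points :: "'a::euclidean_space set \<Rightarrow> ('a \<times> 'a \<Rightarrow> real) \<Rightarrow> 'a set" where
  "lebesgue_points \<Omega> \<sigma> =
     {x \<in> \<Omega>. AE x' in lebesgue_on \<Omega>. \<exists>c. has_lebesgue_value (\<Omega> \<times> \<Omega>) \<sigma> (x, x') c}"

definition lebesgue_value ::
  "'b::euclidean_space set \<Rightarrow> ('b \<Rightarrow> real) \<Rightarrow> 'b \<Rightarrow> real" where
  "lebesgue_value D f p = (THE c. has_lebesgue_value D f p c)"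

text \<open>
  The essential support is the essential (measure-theoretic) closure, in the sense of geometric
  measure theory, of the set where \<open>f\<close> does not vanish: the points at which this set has
  positive upper density. The larger topological support (the complement of the largest open set
  on which \<open>f\<close> vanishes almost everywhere) does not detect reducibility: if \<open>E\<close> and its complement
  both meet every ball in a set of positive measure, then the indicator functions of \<open>E\<close> and of
  its complement both have full topological support, so the decoupled interaction function equal
  to \<open>1\<close> on \<open>E \<times> E\<close> and on \<open>(\<Omega> - E) \<times> (\<Omega> - E)\<close>, and to \<open>0\<close> elsewhere, would have a strongly
  connected graph although the kernel of the adjoint contains both indicator functions.
\<close>

definition ess_support :: "'a::euclidean_space set \<Rightarrow> ('a \<Rightarrow> real) \<Rightarrow> 'a set" where
  "ess_support \<Omega> f =
     {x \<in> \<Omega>. \<not> ((\<lambda>r. measure lebesgue ({z \<in> \<Omega>. f z \<noteq> 0} \<inter> ball x r) / measure lebesgue (ball x r))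
                  \<longlongrightarrow> 0) (at_right 0)}"

definition interaction_graph_strongly_connected ::
  "'a::euclidean_space set \<Rightarrow> ('a \<times> 'a \<Rightarrow> real) \<Rightarrow> bool" where
  "interaction_graph_strongly_connected \<Omega> \<sigma> \<longleftrightarrow>
     strongly_connected (lebesgue_points \<Omega> \<sigma>)
       (\<lambda>x y. y \<in> ess_support \<Omega> (\<lambda>x'. lebesgue_value (\<Omega> \<times> \<Omega>) \<sigma> (x, x'))) \<and>
     ess_inf (lebesgue_on \<Omega>) (total_interaction \<Omega> \<sigma>) > 0"

definition L2_one :: "'a \<Rightarrow> real" where
  "L2_one = (\<lambda>x. 1)"

definition L2_normalized_kernel_function ::
  "'a::euclidean_space set \<Rightarrow> ('a \<times> 'a \<Rightarrow> real) \<Rightarrow> ('a \<Rightarrow> real) \<Rightarrow> bool" where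
  "L2_normalized_kernel_function \<Omega> \<sigma> v \<longleftrightarrow>
     v \<in> L2_kernel \<Omega> (L2_adjoint \<Omega> (interaction_operator \<Omega> \<sigma>)) \<and>
     (AE x in lebesgue_on \<Omega>. v x > 0) \<and> L2_inner \<Omega> v L2_one = 1"

definition L2_cauchy_solution ::
  "'a::euclidean_space set \<Rightarrow> ('a \<times> 'a \<Rightarrow> real) \<Rightarrow> ('a \<Rightarrow> real) \<Rightarrow> (real \<Rightarrow> 'a \<Rightarrow> real) \<Rightarrow> bool" where
  "L2_cauchy_solution \<Omega> \<sigma> yin y \<longleftrightarrow>
     (\<forall>t\<ge>0. y t \<in> L2 \<Omega>) \<and>
     (AE x in lebesgue_on \<Omega>. y 0 x = yin x) \<and>
     (\<forall>t\<ge>0. L2_has_derivative_at \<Omega> y (interaction_operator \<Omega> \<sigma> (y t)) t)"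

definition L2_weighted_mean ::
  "'a::euclidean_space set \<Rightarrow> ('a \<Rightarrow> real) \<Rightarrow> ('a \<Rightarrow> real) \<Rightarrow> 'a \<Rightarrow> real" where
  "L2_weighted_mean \<Omega> v z = (\<lambda>x. L2_inner \<Omega> z v * L2_one x)"

end

theory Submission
  imports Defs
begin

text \<open>
  With \<open>w = S v\<close>, the equation \<open>A\<^sup>* v = 0\<close> says that \<open>w\<close> is invariant under the Markov
  operator \<open>K\<close> with transition density \<open>k(x, y) = \<sigma>(x, y) / S(x)\<close>. The iterates of this operator on
  the constant 1 are uniformly bounded, since \<open>k\<close> is bounded and the integral is preserved. By the
  reverse Fatou lemma their upper limit \<open>g\<close> satisfies \<open>g \<le> K g\<close>, and as both sides have the same
  finite integral, \<open>g\<close> is invariant; its integral is at least that of 1, so \<open>g \<noteq> 0\<close>.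
  For real \<open>v\<close> in the kernel, \<open>\<bar>v\<bar>\<close> is in the kernel as well, and a
  nonnegative element vanishes either almost everywhere or almost nowhere by irreducibility; hence
  uniqueness and positivity. The matrix case is the same argument for the counting measure.

  On \<open>\<Omega>\<close>, irreducibility follows from strong connectedness by Lebesgue's density theorem: if
  \<open>\<sigma>\<close> vanishes on \<open>E \<times> (\<Omega> - E)\<close>, then having positive upper density of \<open>E\<close> is inherited along
  arcs, so almost every point of \<open>\<Omega>\<close> is in \<open>E\<close>, or almost every point is outside \<open>E\<close>.
\<close>

section \<open>Lebesgue's density theorem and Lebesgue values\<close>

text \<open>The iterates need not converge: if all arcs lead from one of two parts of unequal
  measure to the other, the mass in each part alternates with period two. An upper limit always
  exists, and the reverse Fatou inequality is the one that keeps it away from 0. The price is a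
  dominating constant, which comes from \<delta>; the same constant makes the resulting
  \<open>v\<close> bounded, hence square-integrable.

  On \<Omega> the graph is defined pointwise and a path visits only finitely many points, whereas
  irreducibility ignores null sets. A property carried along arcs must therefore make sense at a
  single point and yet not depend on null sets, as positive upper density does. A second obstacle is
  that \<sigma> = 0 almost everywhere on \<open>E \<times> (\<Omega> - E)\<close> says nothing about
  the section at a fixed \<open>x\<close>, which is a null set of the product. Lebesgue values are
  taken jointly in both variables, so densities in the product space have to be compared with
  densities in the factors.\<close>

lemma negligible_low_density_points:
  fixes B :: "'a::euclidean_space set"
  assumes B: "B \<in> sets lebesgue" and "\<eta> > 0"
  shows "negligible {x \<in> B. \<forall>d>0. \<exists>r. 0 < r \<and> r < d \<and>
           \<eta> * measure lebesgue (ball x r) < measure lebesgue (ball x r - B)}" (is "negligible ?T")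
proof (subst negligible_outer_le, intro allI impI)
  fix e :: real assume "e > 0"
  with \<open>\<eta> > 0\<close> have "\<eta> * e > 0" by simp
  \<comment> \<open>The balls in \<open>K\<close> below form a Vitali cover of \<open>?T\<close>.
    Disjoint ones each lose more than the fraction \<eta> of their volume to \<open>U - B\<close>,
    so the excess bound \<open>\<eta> * e\<close> makes their total volume at most
    \<open>e\<close>.\<close>
  obtain U where U: "open U" "B \<subseteq> U" "U - B \<in> lmeasurable"
      "emeasure lebesgue (U - B) < ennreal (\<eta> * e)"
    using sets_lebesgue_outer_open[OF B \<open>\<eta> * e > 0\<close>] .
  define K where "K = {(x, r). 0 < r \<and> ball x r \<subseteq> U \<and>
      \<eta> * measure lebesgue (ball x r) < measure lebesgue (ball x r - B)}"
  have K: "\<exists>i. i \<in> K \<and> x \<in> ball (fst i) (snd i) \<and> snd i < d" if "x \<in> ?T" "0 < d" for x d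
  proof -
    have "x \<in> U" using that U by auto
    then obtain d' where d': "d' > 0" "ball x d' \<subseteq> U"
      using U(1) open_contains_ball by blast
    have "\<forall>d>0. \<exists>r. 0 < r \<and> r < d \<and>
        \<eta> * measure lebesgue (ball x r) < measure lebesgue (ball x r - B)"
      using that(1) by blast
    moreover have "0 < min d d'" using that d' by simp
    ultimately obtain r where r: "0 < r" "r < min d d'"
        "\<eta> * measure lebesgue (ball x r) < measure lebesgue (ball x r - B)"
      by blast
    have "ball x r \<subseteq> U"
      using r d' by (meson min_less_iff_conj order_less_imp_le order_trans subset_ball)
    with r show ?thesis by (intro exI[of _ "(x, r)"]) (auto simp: K_def)
  qed
  obtain C where C: "countable C" "C \<subseteq> K"
    "pairwise (\<lambda>i j. disjnt (ball (fst i) (snd i)) (ball (fst j) (snd j))) C"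
    "negligible (?T - (\<Union>i\<in>C. ball (fst i) (snd i)))"
    using Vitali_covering_theorem_balls[of ?T K fst snd, OF K] by blast
  define b where "b i = ball (fst i) (snd i)" for i :: "'a \<times> real"
  have disj: "disjoint_family_on b C" "disjoint_family_on (\<lambda>i. b i - B) C"
    using C(3) unfolding disjoint_family_on_def pairwise_def disjnt_def b_def by blast+
  have bs: "b i \<in> sets lebesgue" "b i - B \<in> sets lebesgue" for i
    using B by (auto simp: b_def)
  have le: "ennreal \<eta> * emeasure lebesgue (b i) \<le> emeasure lebesgue (b i - B)" if "i \<in> C" for i
  proof -
    have fin: "b i \<in> lmeasurable" "b i - B \<in> lmeasurable"
      using B by (auto simp: b_def intro: fmeasurable_Diff)
    have "\<eta> * measure lebesgue (b i) \<le> measure lebesgue (b i - B)"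
      using that C(2) by (auto simp: K_def b_def)
    then show ?thesis
      using fin \<open>\<eta> > 0\<close>
      by (simp add: emeasure_eq_measure2 flip: ennreal_mult)
  qed
  have "ennreal \<eta> * emeasure lebesgue (\<Union>i\<in>C. b i)
      = (\<integral>\<^sup>+i. ennreal \<eta> * emeasure lebesgue (b i) \<partial>count_space C)"
    by (subst emeasure_UN_countable) (use C(1) disj bs in \<open>auto simp: nn_integral_cmult\<close>)
  also have "\<dots> \<le> (\<integral>\<^sup>+i. emeasure lebesgue (b i - B) \<partial>count_space C)"
    by (intro nn_integral_mono) (use le in auto)
  also have "\<dots> = emeasure lebesgue (\<Union>i\<in>C. b i - B)"
    by (subst emeasure_UN_countable) (use C(1) disj bs in auto)
  also have "\<dots> \<le> emeasure lebesgue (U - B)"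
  proof (rule emeasure_mono)
    have "b i \<subseteq> U" if "i \<in> C" for i
    proof -
      have "i \<in> K" using that C(2) by blast
      then show ?thesis by (cases i) (auto simp: K_def b_def)
    qed
    then show "(\<Union>i\<in>C. b i - B) \<subseteq> U - B" by blast
  qed (use U(3) in auto)
  also have "\<dots> \<le> ennreal \<eta> * ennreal e"
    using U(4) \<open>\<eta> > 0\<close> \<open>e > 0\<close> by (simp add: ennreal_mult)
  finally have small: "emeasure lebesgue (\<Union>i\<in>C. b i) \<le> ennreal e"
    using \<open>\<eta> > 0\<close> by (simp add: ennreal_mult_le_mult_iff)
  have bU: "(\<Union>i\<in>C. b i) \<in> sets lebesgue"
    using C(1) bs by (intro sets.countable_UN'') auto
  define N where "N = ?T - (\<Union>i\<in>C. b i)"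
  have N: "N \<in> null_sets lebesgue"
    using C(4) by (simp add: N_def b_def negligible_iff_null_sets)
  have eq: "emeasure lebesgue ((\<Union>i\<in>C. b i) \<union> N) = emeasure lebesgue (\<Union>i\<in>C. b i)"
    using N bU by (rule emeasure_Un_null_set[rotated])
  have "(\<Union>i\<in>C. b i) \<union> N \<in> lmeasurable"
    using eq small bU N by (auto simp: fmeasurable_def intro: le_less_trans)
  moreover have "measure lebesgue ((\<Union>i\<in>C. b i) \<union> N) \<le> e"
    using eq small \<open>e > 0\<close> by (simp add: measure_def enn2real_leI)
  moreover have "?T \<subseteq> (\<Union>i\<in>C. b i) \<union> N" by (auto simp: N_def)
  ultimately show "\<exists>W. ?T \<subseteq> W \<and> W \<in> lmeasurable \<and> measure lebesgue W \<le> e" by blast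
qed

text \<open>The quotient is the one in \<open>ess_support\<close>, so that the essential support
  consists of the points of \<Omega> where this fails. On a non-measurable set
  \<open>measure\<close> takes its default value 0.\<close>

definition zero_density :: "'a::euclidean_space set \<Rightarrow> 'a \<Rightarrow> bool" where
  "zero_density S x \<longleftrightarrow>
     ((\<lambda>r. measure lebesgue (S \<inter> ball x r) / measure lebesgue (ball x r)) \<longlongrightarrow> 0) (at_right 0)"

text \<open>Where the density of the complement does not tend to 0, its proportion exceeds some
  1/(n+1) at arbitrarily small radii; this is a countable union of the negligible sets
  above.\<close>

theorem AE_zero_density_compl:
  fixes B :: "'a::euclidean_space set"
  assumes B: "B \<in> sets lebesgue"
  shows "AE x in lebesgue. x \<in> B \<longrightarrow> zero_density (- B) x"
proof -
  define T where "T n = {x \<in> B. \<forall>d>0. \<exists>r. 0 < r \<and> r < d \<and>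
           inverse (real (Suc n)) * measure lebesgue (ball x r) < measure lebesgue (ball x r - B)}" for n
  have "negligible (T n)" for n
    unfolding T_def using B by (rule negligible_low_density_points) simp
  then have "(\<Union>n. T n) \<in> null_sets lebesgue"
    by (auto simp: negligible_iff_null_sets intro!: null_sets_UN)
  then show ?thesis
  proof (rule AE_I', intro subsetI)
    fix x assume "x \<in> {x \<in> space lebesgue. \<not> (x \<in> B \<longrightarrow> zero_density (- B) x)}"
    then have "x \<in> B" and nT: "\<not> zero_density (- B) x" by auto
    show "x \<in> (\<Union>n. T n)"
    proof (rule ccontr)
      assume x: "x \<notin> (\<Union>n. T n)"
      have "zero_density (- B) x"
        unfolding zero_density_def
      proof (rule tendstoI)
        fix e :: real assume "e > 0"
        then obtain n where n: "inverse (real (Suc n)) < e"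
          using reals_Archimedean by blast
        obtain d where d: "d > 0" "\<And>r. 0 < r \<Longrightarrow> r < d \<Longrightarrow>
           measure lebesgue (ball x r - B) \<le> inverse (real (Suc n)) * measure lebesgue (ball x r)"
        proof -
          have "x \<notin> T n" using x by blast
          then have "\<exists>d>0. \<forall>r. 0 < r \<and> r < d \<longrightarrow>
              \<not> inverse (real (Suc n)) * measure lebesgue (ball x r) < measure lebesgue (ball x r - B)"
            using \<open>x \<in> B\<close> unfolding T_def by blast
          then show ?thesis using that by (meson not_less)
        qed
        have "dist (measure lebesgue (- B \<inter> ball x r) / measure lebesgue (ball x r)) 0 < e"
          if "0 < r" "r < d" for r
        proof -
          have "- B \<inter> ball x r = ball x r - B" by auto
          then have "measure lebesgue (- B \<inter> ball x r) / measure lebesgue (ball x r)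
              \<le> inverse (real (Suc n))"
            using d(2)[OF that] that by (simp add: pos_divide_le_eq)
          with n show ?thesis by simp
        qed
        then show "\<forall>\<^sub>F r in at_right 0.
            dist (measure lebesgue (- B \<inter> ball x r) / measure lebesgue (ball x r)) 0 < e"
          using \<open>d > 0\<close> by (auto simp: eventually_at_right_field)
      qed
      with nT show False by simp
    qed
  qed
qed

text \<open>For bounded functions, Lebesgue differentiation reduces to the density theorem. Near
  \<open>p\<close> most points share a narrow level set with \<open>p\<close>, where
  \<open>f\<close> differs little from \<open>f p\<close>; the remaining points contribute at most a
  constant times their proportion, which tends to 0.\<close>

lemma AE_has_lebesgue_value:
  fixes f :: "'a::euclidean_space \<Rightarrow> real"
  assumes D: "open D" and f: "f \<in> borel_measurable (lebesgue_on D)"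
    and bd: "AE x in lebesgue_on D. \<bar>f x\<bar> \<le> M"
  shows "AE p in lebesgue_on D. has_lebesgue_value D f p (f p)"
proof -
  have [measurable]: "D \<in> sets lebesgue" using D by auto
  \<comment> \<open>For fixed \<open>n\<close> the half-open level sets of width 1/(n+1) partition
    \<open>D\<close>. There are countably many over all \<open>n\<close> and \<open>k\<close>, so
    one null set serves for all of them.\<close>
  define B where "B n k = {p \<in> D. of_int k \<le> real (Suc n) * f p \<and> real (Suc n) * f p < of_int k + 1}"
    for n and k :: int
  have B: "B n k \<in> sets lebesgue" for n k
  proof -
    have "{p \<in> space (lebesgue_on D). of_int k \<le> real (Suc n) * f p \<and> real (Suc n) * f p < of_int k + 1}
        \<in> sets (lebesgue_on D)"
      using f by measurable
    then show ?thesis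
      by (simp add: B_def sets_restrict_space_iff)
  qed
  have "AE x in lebesgue. \<forall>n k. x \<in> B n k \<longrightarrow> zero_density (- B n k) x"
    unfolding AE_all_countable using AE_zero_density_compl[OF B] by blast
  then have "AE x in lebesgue_on D. \<forall>n k. x \<in> B n k \<longrightarrow> zero_density (- B n k) x"
    by (subst AE_restrict_space_iff) auto
  then show ?thesis
    using AE_space
  proof eventually_elim
    fix p assume dens: "\<forall>n k. p \<in> B n k \<longrightarrow> zero_density (- B n k) p"
      and "p \<in> space (lebesgue_on D)"
    then have "p \<in> D" by simp
    obtain d where d: "d > 0" "ball p d \<subseteq> D"
      using D \<open>p \<in> D\<close> open_contains_ball by blast
    \<comment> \<open>Bounds \<open>\<bar>f q - f p\<bar>\<close> for almost every \<open>q\<close>,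
      whatever the value \<open>f p\<close>; the summand 1 makes it positive for the division by
      \<open>2 * M'\<close>.\<close>
    define M' where "M' = \<bar>M\<bar> + \<bar>f p\<bar> + 1"
    have "M' > 0" by (simp add: M'_def)
    show "has_lebesgue_value D f p (f p)"
      unfolding has_lebesgue_value_def
    proof (rule tendstoI)
      fix e :: real assume "e > 0"
      then obtain n where n: "inverse (real (Suc n)) < e / 2"
        using reals_Archimedean[of "e / 2"] by auto
      define k where "k = \<lfloor>real (Suc n) * f p\<rfloor>"
      have "p \<in> B n k" using \<open>p \<in> D\<close> by (simp add: B_def k_def del: of_nat_Suc)
      then have "zero_density (- B n k) p" using dens by blast
      then have "\<forall>\<^sub>F r in at_right 0.
         dist (measure lebesgue (- B n k \<inter> ball p r) / measure lebesgue (ball p r)) 0 < e / (2 * M')"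
        unfolding zero_density_def by (rule tendstoD) (use \<open>e > 0\<close> \<open>M' > 0\<close> in simp)
      moreover have "\<forall>\<^sub>F r in at_right (0::real). r < d"
        using d(1) by (auto simp: eventually_at_right_field)
      moreover have "\<forall>\<^sub>F r in at_right (0::real). r > 0"
        by (simp add: eventually_at_right_less)
      ultimately show "\<forall>\<^sub>F r in at_right 0.
         dist ((LINT q|lebesgue_on (D \<inter> ball p r). \<bar>f q - f p\<bar>) / measure lebesgue (D \<inter> ball p r)) 0 < e"
      proof eventually_elim
        case (elim r)
        have eq: "D \<inter> ball p r = ball p r" using d elim by (auto simp: subset_iff)
        let ?b = "measure lebesgue (ball p r)"
        have "?b > 0" using elim by simp
        let ?L = "lebesgue_on (ball p r)"
        interpret finite_measure ?L by (rule finite_measure_lebesgue_on) simp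
        have fr: "f \<in> borel_measurable ?L"
          by (rule measurable_restrict_mono[OF f]) (use eq in auto)
        have bdr: "AE q in ?L. \<bar>f q\<bar> \<le> M"
        proof -
          have "AE q in lebesgue. q \<in> D \<longrightarrow> \<bar>f q\<bar> \<le> M"
            using bd by (subst (asm) AE_restrict_space_iff) auto
          then have "AE q in lebesgue. q \<in> ball p r \<longrightarrow> \<bar>f q\<bar> \<le> M"
            by eventually_elim (use eq in blast)
          then show ?thesis by (subst AE_restrict_space_iff) auto
        qed
        have Bm: "- B n k \<inter> ball p r \<in> sets ?L"
        proof -
          have "- B n k \<inter> ball p r = ball p r - B n k" by auto
          then show ?thesis using B by (auto simp: sets_restrict_space_iff)
        qed
        have ind: "integrable ?L (indicat_real (- B n k \<inter> ball p r))"
          using Bm emeasure_finite by (intro integrable_real_indicator) (auto simp: less_top[symmetric])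
        have indI: "(LINT q|?L. indicat_real (- B n k \<inter> ball p r) q)
            = measure lebesgue (- B n k \<inter> ball p r)"
          using Bm by (simp add: measure_restrict_space)
        have int1: "integrable ?L (\<lambda>q. \<bar>f q - f p\<bar>)"
        proof (rule integrable_const_bound)
          show "AE q in ?L. norm \<bar>f q - f p\<bar> \<le> M'" using bdr by eventually_elim (simp add: M'_def)
        qed (intro borel_measurable_abs borel_measurable_diff fr borel_measurable_const)
        have "(LINT q|?L. \<bar>f q - f p\<bar>)
            \<le> (LINT q|?L. inverse (real (Suc n)) + M' * indicator (- B n k \<inter> ball p r) q)"
        proof (rule integral_mono_AE[OF int1])
          show "integrable ?L (\<lambda>q. inverse (real (Suc n)) + M' * indicator (- B n k \<inter> ball p r) q)"
            by (intro Bochner_Integration.integrable_add integrable_mult_right ind) auto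
          show "AE q in ?L. \<bar>f q - f p\<bar> \<le> inverse (real (Suc n)) + M' * indicator (- B n k \<inter> ball p r) q"
            using bdr AE_space
          proof eventually_elim
            case (elim q)
            show ?case
            proof (cases "q \<in> B n k")
              case True
              then have "\<bar>real (Suc n) * f q - real (Suc n) * f p\<bar> \<le> 1"
                using \<open>p \<in> B n k\<close> by (auto simp: B_def)
              then have "real (Suc n) * \<bar>f q - f p\<bar> \<le> 1"
                by (simp only: right_diff_distrib[symmetric] abs_mult)
              then show ?thesis using True by (simp add: field_simps)
            next
              case False
              have "\<bar>f q - f p\<bar> \<le> M'" using elim by (simp add: M'_def)
              then show ?thesis using False elim by (simp add: add_increasing)
            qed
          qed
        qed
        also have "\<dots> = inverse (real (Suc n)) * ?b + M' * measure lebesgue (- B n k \<inter> ball p r)"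
          using ind indI by (subst Bochner_Integration.integral_add) (auto simp: measure_restrict_space)
        finally have "(LINT q|?L. \<bar>f q - f p\<bar>) / ?b
           \<le> (inverse (real (Suc n)) * ?b + M' * measure lebesgue (- B n k \<inter> ball p r)) / ?b"
          by (rule divide_right_mono) simp
        also have "\<dots> = inverse (real (Suc n)) + M' * (measure lebesgue (- B n k \<inter> ball p r) / ?b)"
          using \<open>?b > 0\<close> by (simp add: add_divide_distrib del: of_nat_Suc)
        also have "\<dots> < e / 2 + M' * (e / (2 * M'))"
          using n elim \<open>M' > 0\<close> by (intro add_strict_mono mult_strict_left_mono) auto
        also have "\<dots> = e" using \<open>M' > 0\<close> by simp
        finally show ?case using \<open>?b > 0\<close> by (simp add: eq abs_of_nonneg)
      qed
    qed
  qed
qed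

section \<open>Comparison of densities, in one space and in products\<close>

text \<open>\<open>A\<close> may be non-measurable: the default value 0 of \<open>measure\<close>
  respects the inequality. This is applied to the set where a section of Lebesgue values is
  nonzero.\<close>

lemma zero_density_mono:
  assumes zd: "zero_density B x" and B: "B \<in> sets lebesgue" and N: "negligible N" and sub: "A \<subseteq> B \<union> N"
  shows "zero_density A x"
  unfolding zero_density_def
proof (rule tendsto_sandwich[OF _ _ tendsto_const zd[unfolded zero_density_def]])
  have "measure lebesgue (A \<inter> ball x r) \<le> measure lebesgue (B \<inter> ball x r)" for r
  proof (cases "A \<inter> ball x r \<in> sets lebesgue")
    case True
    have Br: "B \<inter> ball x r \<in> lmeasurable"
      using B by (intro bounded_set_imp_lmeasurable) auto
    have N': "N \<in> null_sets lebesgue" using N by (simp add: negligible_iff_null_sets)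
    have "measure lebesgue (A \<inter> ball x r) \<le> measure lebesgue ((B \<inter> ball x r) \<union> N)"
      using sub True Br N negligible_imp_measurable
      by (intro measure_mono_fmeasurable) (auto intro: fmeasurable.Un)
    also have "\<dots> = measure lebesgue (B \<inter> ball x r)"
      using Br N' by (intro measure_Un_null_set) auto
    finally show ?thesis .
  qed (simp add: measure_notin_sets)
  then show "\<forall>\<^sub>F r in at_right 0. measure lebesgue (A \<inter> ball x r) / measure lebesgue (ball x r)
      \<le> measure lebesgue (B \<inter> ball x r) / measure lebesgue (ball x r)"
    by (intro always_eventually allI divide_right_mono) auto
qed auto

lemma ball_measure_split:
  fixes x :: "'a::euclidean_space"
  assumes "A \<in> sets lebesgue" and "0 < r"
  shows "measure lebesgue (A \<inter> ball x r) / measure lebesgue (ball x r)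
       + measure lebesgue (- A \<inter> ball x r) / measure lebesgue (ball x r) = 1"
proof -
  have "A \<inter> ball x r \<in> lmeasurable"
    using assms by (auto intro!: bounded_set_imp_lmeasurable)
  then have "measure lebesgue (A \<inter> ball x r \<union> ball x r)
      = measure lebesgue (A \<inter> ball x r) + measure lebesgue (ball x r - A \<inter> ball x r)"
    by (rule measure_Un2) simp
  moreover have "A \<inter> ball x r \<union> ball x r = ball x r" "ball x r - A \<inter> ball x r = - A \<inter> ball x r"
    by auto
  ultimately have "measure lebesgue (A \<inter> ball x r) + measure lebesgue (- A \<inter> ball x r) = measure lebesgue (ball x r)"
    by simp
  then show ?thesis using \<open>0 < r\<close> by (simp flip: add_divide_distrib)
qed

lemma not_zero_density_both:
  assumes "A \<in> sets lebesgue" "zero_density A x" "zero_density (- A) x"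
  shows False
proof -
  have "((\<lambda>r. measure lebesgue (A \<inter> ball x r) / measure lebesgue (ball x r)
       + measure lebesgue (- A \<inter> ball x r) / measure lebesgue (ball x r)) \<longlongrightarrow> 0 + 0) (at_right 0)"
    using assms(2,3) unfolding zero_density_def by (rule tendsto_add)
  moreover have "\<forall>\<^sub>F r in at_right 0. measure lebesgue (A \<inter> ball x r) / measure lebesgue (ball x r)
       + measure lebesgue (- A \<inter> ball x r) / measure lebesgue (ball x r) = 1"
    using eventually_at_right_less[of "0::real"]
    by eventually_elim (rule ball_measure_split[OF assms(1)])
  ultimately have "((\<lambda>r::real. 1::real) \<longlongrightarrow> 0 + 0) (at_right 0)"
    by (rule Lim_transform_eventually)
  then show False by (simp add: tendsto_const_iff)
qed

text \<open>The proportion of \<open>E\<close> times that of \<open>Z\<close> is at most a constant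
  times the proportion of \<open>E \<times> Z\<close> in a ball of twice the radius. The first
  product tends to 0, and the proportion of \<open>Z\<close> tends to 1.\<close>

lemma zero_density_Times_imp:
  fixes E Z :: "'a::euclidean_space set"
  assumes E: "E \<in> sets borel" and Z: "Z \<in> sets borel"
    and zd: "zero_density (E \<times> Z) (x, z)" and zdZ: "zero_density (- Z) z"
  shows "zero_density E x"
proof -
  let ?d = "\<lambda>S x r. measure lebesgue (S \<inter> ball x r) / measure lebesgue (ball x r)"
  let ?v = "measure lebesgue (ball (0::'a) 1)" and ?w = "measure lebesgue (ball (0::'a \<times> 'a) 1)"
  \<comment> \<open>The volume of a ball of radius \<open>2 * r\<close> in the product, divided by
    the product of the volumes of two balls of radius \<open>r\<close>. The powers of
    \<open>r\<close> cancel, as the dimension doubles.\<close>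
  define K where "K = 2 ^ DIM('a \<times> 'a) * ?w / (?v * ?v)"
  have le: "?d E x r \<le> K * ?d (E \<times> Z) (x, z) (2 * r) + ?d (- Z) z r" if "0 < r" for r
  proof -
    have vol: "measure lebesgue (ball x r) = r ^ DIM('a) * ?v" "measure lebesgue (ball z r) = r ^ DIM('a) * ?v"
      "measure lebesgue (ball (x, z) (2 * r)) = (2 * r) ^ DIM('a \<times> 'a) * ?w"
      using \<open>0 < r\<close> content_ball_conv_unit_ball[of r x] content_ball_conv_unit_ball[of r z]
        content_ball_conv_unit_ball[of "2 * r" "(x, z)"] by simp_all
    have "?v > 0" "?w > 0" by simp_all
    have m: "measure lebesgue (E \<inter> ball x r) * measure lebesgue (Z \<inter> ball z r)
        = measure lebesgue ((E \<inter> ball x r) \<times> (Z \<inter> ball z r))"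
    proof -
      have "emeasure (lborel \<Otimes>\<^sub>M lborel) ((E \<inter> ball x r) \<times> (Z \<inter> ball z r))
          = emeasure lborel (E \<inter> ball x r) * emeasure lborel (Z \<inter> ball z r)"
        using E Z by (intro lborel.emeasure_pair_measure_Times) auto
      moreover have "(E \<inter> ball x r) \<times> (Z \<inter> ball z r) \<in> sets borel"
        using E Z by (intro borel_Times) auto
      ultimately show ?thesis
        using E Z by (simp add: measure_def lborel_prod enn2real_mult)
    qed
    have sub: "(E \<inter> ball x r) \<times> (Z \<inter> ball z r) \<subseteq> (E \<times> Z) \<inter> ball (x, z) (2 * r)"
    proof -
      have "dist (x, z) (a, b) < 2 * r" if "dist x a < r" "dist z b < r" for a b
      proof -
        have "dist (x, z) (a, b) \<le> dist x a + dist z b"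
          unfolding dist_prod_def by (simp add: sqrt_sum_squares_le_sum)
        with that show ?thesis by simp
      qed
      then show ?thesis by auto
    qed
    have "measure lebesgue ((E \<inter> ball x r) \<times> (Z \<inter> ball z r)) \<le> measure lebesgue ((E \<times> Z) \<inter> ball (x, z) (2 * r))"
    proof (rule measure_mono_fmeasurable[OF sub])
      have "(E \<inter> ball x r) \<times> (Z \<inter> ball z r) \<in> sets borel" using E Z by (intro borel_Times) auto
      then show "(E \<inter> ball x r) \<times> (Z \<inter> ball z r) \<in> sets lebesgue" by simp
      have "E \<times> Z \<in> sets borel" using E Z by (intro borel_Times)
      then show "(E \<times> Z) \<inter> ball (x, z) (2 * r) \<in> lmeasurable"
        by (intro bounded_set_imp_lmeasurable) auto
    qed
    then have prod: "?d E x r * ?d Z z r \<le> K * ?d (E \<times> Z) (x, z) (2 * r)"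
      unfolding m[symmetric] vol K_def
      using \<open>?v > 0\<close> \<open>?w > 0\<close> \<open>0 < r\<close>
      by (simp add: power_mult_distrib power_add field_simps)
    have "E \<in> sets lebesgue" "0 \<le> ?d (- E) x r" using E by simp_all
    with ball_measure_split[OF this(1) \<open>0 < r\<close>, of x] have "?d E x r \<le> 1" by linarith
    then have "?d E x r * ?d (- Z) z r \<le> 1 * ?d (- Z) z r"
      by (rule mult_right_mono) simp
    moreover have "?d Z z r = 1 - ?d (- Z) z r"
      using ball_measure_split[of Z r z] Z \<open>0 < r\<close> by simp
    then have "?d E x r = ?d E x r * ?d Z z r + ?d E x r * ?d (- Z) z r"
      by (simp only: right_diff_distrib mult_1_right diff_add_cancel)
    ultimately show ?thesis using prod by linarith
  qed
  have "filterlim (\<lambda>r::real. 2 * r) (at_right 0) (at_right 0)"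
    by (rule filterlim_times_pos[OF filterlim_ident]) auto
  from filterlim_compose[OF zd[unfolded zero_density_def] this]
  have "((\<lambda>r. K * ?d (E \<times> Z) (x, z) (2 * r) + ?d (- Z) z r) \<longlongrightarrow> K * 0 + 0) (at_right 0)"
    using zdZ unfolding zero_density_def by (intro tendsto_add tendsto_mult tendsto_const)
  then have lim: "((\<lambda>r. K * ?d (E \<times> Z) (x, z) (2 * r) + ?d (- Z) z r) \<longlongrightarrow> 0) (at_right 0)" by simp
  show ?thesis
    unfolding zero_density_def
  proof (rule tendsto_sandwich[OF _ _ tendsto_const lim])
    show "\<forall>\<^sub>F r in at_right 0. ?d E x r \<le> K * ?d (E \<times> Z) (x, z) (2 * r) + ?d (- Z) z r"
      using eventually_at_right_less[of "0::real"] by eventually_elim (rule le)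
  qed auto
qed

section \<open>Uniqueness of Lebesgue values and density at nonzero values\<close>

lemma integrable_diff_const_ball:
  fixes f :: "'a::euclidean_space \<Rightarrow> real"
  assumes f: "f \<in> borel_measurable borel" and bd: "\<And>q. \<bar>f q\<bar> \<le> M"
  shows "integrable (lebesgue_on (ball p r)) (\<lambda>q. \<bar>f q - k\<bar>)"
proof -
  interpret finite_measure "lebesgue_on (ball p r)" by (rule finite_measure_lebesgue_on) simp
  have f': "f \<in> borel_measurable (lebesgue_on (ball p r))"
    using f by (intro measurable_restrict_space1 measurable_completion) simp
  show ?thesis
  proof (rule integrable_const_bound)
    show "AE q in lebesgue_on (ball p r). norm \<bar>f q - k\<bar> \<le> M + \<bar>k\<bar>"
    proof (rule AE_I2)
      fix q show "norm \<bar>f q - k\<bar> \<le> M + \<bar>k\<bar>" using bd[of q] by simp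
    qed
  qed (use f' in simp)
qed

lemma eventually_ball_subset:
  assumes "open D" "p \<in> D"
  shows "\<forall>\<^sub>F r in at_right 0. 0 < r \<and> D \<inter> ball p r = ball p r"
proof -
  obtain d where "d > 0" "ball p d \<subseteq> D" using assms open_contains_ball by blast
  moreover have "D \<inter> ball p r = ball p r" if "r < d" for r
    using that \<open>ball p d \<subseteq> D\<close> by (auto simp: subset_iff)
  ultimately show ?thesis by (auto simp: eventually_at_right_field)
qed

text \<open>Makes the \<open>THE\<close> in \<open>lebesgue_value\<close> meaningful. The inequality
  \<open>\<bar>a - b\<bar> \<le> \<bar>f q - a\<bar> + \<bar>f q - b\<bar>\<close> is averaged over
  small balls.\<close>

lemma has_lebesgue_value_unique:
  fixes f :: "'a::euclidean_space \<Rightarrow> real"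
  assumes f: "f \<in> borel_measurable borel" "\<And>q. \<bar>f q\<bar> \<le> M" and D: "open D" "p \<in> D"
    and a: "has_lebesgue_value D f p a" and b: "has_lebesgue_value D f p b"
  shows "a = b"
proof -
  let ?m = "\<lambda>k r. (LINT q|lebesgue_on (D \<inter> ball p r). \<bar>f q - k\<bar>) / measure lebesgue (D \<inter> ball p r)"
  have "((\<lambda>r. ?m a r + ?m b r) \<longlongrightarrow> 0 + 0) (at_right 0)"
    using a b unfolding has_lebesgue_value_def by (rule tendsto_add)
  moreover have "\<forall>\<^sub>F r in at_right 0. \<bar>a - b\<bar> \<le> ?m a r + ?m b r"
    using eventually_ball_subset[OF D]
  proof eventually_elim
    case (elim r)
    let ?L = "lebesgue_on (ball p r)"
    interpret finite_measure ?L by (rule finite_measure_lebesgue_on) simp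
    have "\<bar>a - b\<bar> * measure lebesgue (ball p r) = (LINT q|?L. \<bar>a - b\<bar>)"
      by (simp add: measure_restrict_space)
    also have "\<dots> \<le> (LINT q|?L. \<bar>f q - a\<bar> + \<bar>f q - b\<bar>)"
      by (intro integral_mono Bochner_Integration.integrable_add integrable_diff_const_ball[OF f]) auto
    also have "\<dots> = (LINT q|?L. \<bar>f q - a\<bar>) + (LINT q|?L. \<bar>f q - b\<bar>)"
      by (intro Bochner_Integration.integral_add integrable_diff_const_ball[OF f])
    finally show ?case using elim by (simp add: field_simps)
  qed
  ultimately have "\<bar>a - b\<bar> \<le> 0 + 0"
    by (intro tendsto_lowerbound[of _ _ "at_right (0::real)"]) auto
  then show ?thesis by simp
qed

text \<open>Chebyshev's inequality: almost everywhere on \<open>B\<close> the deviation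
  \<open>\<bar>f - k\<bar>\<close> equals \<open>\<bar>k\<bar>\<close>, so the proportion of
  \<open>B\<close> in a ball is at most the mean deviation divided by
  \<open>\<bar>k\<bar>\<close>.\<close>

lemma zero_density_at_nonzero_value:
  fixes f :: "'a::euclidean_space \<Rightarrow> real"
  assumes f: "f \<in> borel_measurable borel" "\<And>q. \<bar>f q\<bar> \<le> M" and D: "open D" "p \<in> D"
    and k: "has_lebesgue_value D f p k" "k \<noteq> 0"
    and B: "B \<in> sets lebesgue" and ae: "AE q in lebesgue. q \<in> B \<longrightarrow> f q = 0"
  shows "zero_density B p"
proof -
  let ?m = "\<lambda>r. (LINT q|lebesgue_on (D \<inter> ball p r). \<bar>f q - k\<bar>) / measure lebesgue (D \<inter> ball p r)"
  have "((\<lambda>r. ?m r / \<bar>k\<bar>) \<longlongrightarrow> 0 / \<bar>k\<bar>) (at_right 0)"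
    using k unfolding has_lebesgue_value_def by (intro tendsto_divide tendsto_const) auto
  then have lim: "((\<lambda>r. ?m r / \<bar>k\<bar>) \<longlongrightarrow> 0) (at_right 0)" by simp
  show ?thesis
    unfolding zero_density_def
  proof (rule tendsto_sandwich[OF _ _ tendsto_const lim])
    show "\<forall>\<^sub>F r in at_right 0. measure lebesgue (B \<inter> ball p r) / measure lebesgue (ball p r) \<le> ?m r / \<bar>k\<bar>"
      using eventually_ball_subset[OF D]
    proof eventually_elim
      case (elim r)
      let ?L = "lebesgue_on (ball p r)"
      interpret finite_measure ?L by (rule finite_measure_lebesgue_on) simp
      have Bm: "B \<inter> ball p r \<in> sets ?L"
        using B by (auto simp: sets_restrict_space_iff)
      have ind: "integrable ?L (indicat_real (B \<inter> ball p r))"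
        using Bm emeasure_finite by (intro integrable_real_indicator) (auto simp: less_top[symmetric])
      have "\<bar>k\<bar> * measure lebesgue (B \<inter> ball p r) = (LINT q|?L. \<bar>k\<bar> * indicat_real (B \<inter> ball p r) q)"
        using Bm by (simp add: measure_restrict_space)
      also have "\<dots> \<le> (LINT q|?L. \<bar>f q - k\<bar>)"
      proof (rule integral_mono_AE)
        show "integrable ?L (\<lambda>q. \<bar>k\<bar> * indicat_real (B \<inter> ball p r) q)" using ind by simp
        show "integrable ?L (\<lambda>q. \<bar>f q - k\<bar>)" by (rule integrable_diff_const_ball[OF f])
        have "AE q in ?L. q \<in> B \<longrightarrow> f q = 0"
          using ae by (subst AE_restrict_space_iff) auto
        then show "AE q in ?L. \<bar>k\<bar> * indicat_real (B \<inter> ball p r) q \<le> \<bar>f q - k\<bar>"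
          by eventually_elim (auto simp: indicator_def)
      qed
      finally show ?case using elim \<open>k \<noteq> 0\<close> by (simp add: field_simps)
    qed
  qed auto
qed

section \<open>Stationary densities of irreducible kernels\<close>

text \<open>Covers the counting measure on a finite type as well as Lebesgue measure on a bounded
  open set. The bounds on \<open>s\<close> hold everywhere, which keeps null sets out of the
  estimates under the integral. In \<open>irreducible\<close>, \<open>E\<close> is a set that
  nothing leaves along \<open>s\<close>.\<close>

locale irreducible_kernel = finite_measure M for M :: "'b measure" +
  fixes s :: "'b \<Rightarrow> 'b \<Rightarrow> real" and c \<delta> :: real
  assumes measurable_s [measurable]: "case_prod s \<in> borel_measurable (M \<Otimes>\<^sub>M M)"
    and s_nonneg: "0 \<le> s x y" and s_le: "s x y \<le> c"
    and \<delta>_pos: "0 < \<delta>" and \<delta>_le: "AE x in M. \<delta> \<le> (\<integral>y. s x y \<partial>M)"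
    and space_nonnull: "emeasure M (space M) \<noteq> 0"
    and irreducible: "E \<in> sets M \<Longrightarrow> AE x in M. AE y in M. x \<in> E \<longrightarrow> y \<notin> E \<longrightarrow> s x y = 0 \<Longrightarrow>
          (AE x in M. x \<in> E) \<or> (AE x in M. x \<notin> E)"
begin

sublocale pair_sigma_finite M M ..

definition out_rate :: "'b \<Rightarrow> real" where
  "out_rate x = (\<integral>y. s x y \<partial>M)"

text \<open>Inflow equals outflow, that is, the adjoint equation, but for integrable rather than
  square-integrable \<open>v\<close>, because the arguments below compare integrals.\<close>

definition stationary :: "('b \<Rightarrow> real) \<Rightarrow> bool" where
  "stationary v \<longleftrightarrow> integrable M v \<and> (AE y in M. (\<integral>x. s x y * v x \<partial>M) = out_rate y * v y)"

lemma measurable_out_rate [measurable]: "out_rate \<in> borel_measurable M"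
  unfolding out_rate_def by measurable

lemma c_nonneg: "0 \<le> c"
  using s_nonneg s_le by (rule order_trans)

lemma measurable_s1: "y \<in> space M \<Longrightarrow> (\<lambda>x. s x y) \<in> borel_measurable M"
  by measurable

lemma integrable_s2: "x \<in> space M \<Longrightarrow> integrable M (s x)"
  by (rule integrable_const_bound[where B = c]) (auto simp: s_nonneg s_le)

lemma out_rate_nonneg: "0 \<le> out_rate x"
  unfolding out_rate_def by (simp add: s_nonneg)

lemma out_rate_le: "x \<in> space M \<Longrightarrow> out_rate x \<le> c * measure M (space M)"
  unfolding out_rate_def
  using integral_mono[OF integrable_s2, of x "\<lambda>_. c"] by (simp add: s_le mult.commute)

lemma integrable_s_mult:
  assumes "integrable M v" and y: "y \<in> space M"
  shows "integrable M (\<lambda>x. s x y * v x)"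
proof (rule Bochner_Integration.integrable_bound)
  show "integrable M (\<lambda>x. c * v x)" using assms by simp
  show "AE x in M. norm (s x y * v x) \<le> norm (c * v x)"
    using s_nonneg s_le c_nonneg by (auto simp: abs_mult intro!: mult_right_mono)
qed (use assms measurable_s1 in auto)

lemma integrable_pair_s_mult:
  assumes [measurable]: "integrable M v"
  shows "integrable (M \<Otimes>\<^sub>M M) (\<lambda>(x, y). s x y * v x)"
proof (rule Fubini_integrable)
  have "integrable M (\<lambda>x. out_rate x * \<bar>v x\<bar>)"
  proof (rule Bochner_Integration.integrable_bound)
    show "integrable M (\<lambda>x. (c * measure M (space M)) * v x)" using assms by simp
    show "AE x in M. norm (out_rate x * \<bar>v x\<bar>) \<le> norm ((c * measure M (space M)) * v x)"
      using out_rate_le out_rate_nonneg c_nonneg by (auto simp: abs_mult intro!: AE_I2 mult_right_mono)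
  qed measurable
  moreover have "(\<integral>y. norm (case (x, y) of (x, y) \<Rightarrow> s x y * v x) \<partial>M) = out_rate x * \<bar>v x\<bar>" for x
    by (simp add: abs_mult s_nonneg out_rate_def)
  ultimately show "integrable M (\<lambda>x. \<integral>y. norm (case (x, y) of (x, y) \<Rightarrow> s x y * v x) \<partial>M)"
    by simp
  show "AE x in M. integrable M (\<lambda>y. case (x, y) of (x, y) \<Rightarrow> s x y * v x)"
    using integrable_s2 by (auto intro!: AE_I2)
qed measurable

text \<open>Conservation of mass, by Fubini. It turns a one-sided inequality between inflow and
  outflow into equality almost everywhere.\<close>

lemma integral_flow_eq:
  assumes "integrable M v"
  shows "(\<integral>y. (\<integral>x. s x y * v x \<partial>M) \<partial>M) = (\<integral>x. out_rate x * v x \<partial>M)"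
  using Fubini_integral[of "\<lambda>x y. s x y * v x"] integrable_pair_s_mult[OF assms]
  by (simp add: out_rate_def)

lemma integrable_inflow:
  "integrable M v \<Longrightarrow> integrable M (\<lambda>y. \<integral>x. s x y * v x \<partial>M)"
  using integrable_snd[of "\<lambda>x y. s x y * v x"] integrable_pair_s_mult by simp

lemma integrable_outflow:
  "integrable M v \<Longrightarrow> integrable M (\<lambda>x. out_rate x * v x)"
  using integrable_fst[of "\<lambda>x y. s x y * v x"] integrable_pair_s_mult by (simp add: out_rate_def)

lemma stationary_lincomb:
  assumes "stationary v" "stationary w"
  shows "stationary (\<lambda>x. a * v x + b * w x)"
proof -
  have int: "integrable M v" "integrable M w"
    and ae: "AE y in M. (\<integral>x. s x y * v x \<partial>M) = out_rate y * v y"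
      "AE y in M. (\<integral>x. s x y * w x \<partial>M) = out_rate y * w y"
    using assms by (auto simp: stationary_def)
  have "AE y in M. (\<integral>x. s x y * (a * v x + b * w x) \<partial>M) = out_rate y * (a * v y + b * w y)"
    using ae AE_space
  proof eventually_elim
    case (elim y)
    have "(\<integral>x. s x y * (a * v x + b * w x) \<partial>M) = (\<integral>x. a * (s x y * v x) + b * (s x y * w x) \<partial>M)"
      by (simp add: algebra_simps)
    also have "\<dots> = a * (\<integral>x. s x y * v x \<partial>M) + b * (\<integral>x. s x y * w x \<partial>M)"
      using integrable_s_mult[OF int(1) elim(3)] integrable_s_mult[OF int(2) elim(3)] by simp
    finally show ?case using elim by (simp add: algebra_simps)
  qed
  then show ?thesis using int by (simp add: stationary_def)
qed

text \<open>Pointwise the modulus can only increase the inflow, but the total inflow and outflow agree.\<close>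

lemma stationary_abs:
  assumes "stationary v"
  shows "stationary (\<lambda>x. \<bar>v x\<bar>)"
proof -
  have int: "integrable M v"
    and ae: "AE y in M. (\<integral>x. s x y * v x \<partial>M) = out_rate y * v y"
    using assms by (auto simp: stationary_def)
  then have inta: "integrable M (\<lambda>x. \<bar>v x\<bar>)" by simp
  define d where "d y = (\<integral>x. s x y * \<bar>v x\<bar> \<partial>M) - out_rate y * \<bar>v y\<bar>" for y
  have d_nonneg: "AE y in M. 0 \<le> d y"
    using ae AE_space
  proof eventually_elim
    case (elim y)
    have "out_rate y * \<bar>v y\<bar> = \<bar>\<integral>x. s x y * v x \<partial>M\<bar>"
      using elim out_rate_nonneg by (simp add: abs_mult)
    also have "\<dots> \<le> (\<integral>x. \<bar>s x y * v x\<bar> \<partial>M)" by (rule integral_abs_bound)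
    also have "\<dots> = (\<integral>x. s x y * \<bar>v x\<bar> \<partial>M)" by (simp add: abs_mult s_nonneg)
    finally show ?case by (simp add: d_def)
  qed
  have "integrable M d"
    unfolding d_def using integrable_inflow[OF inta] integrable_outflow[OF inta] by simp
  moreover have "(\<integral>y. d y \<partial>M) = 0"
    unfolding d_def using integrable_inflow[OF inta] integrable_outflow[OF inta] integral_flow_eq[OF inta]
    by simp
  ultimately have "AE y in M. d y = 0"
    using d_nonneg integral_nonneg_eq_0_iff_AE by blast
  then show ?thesis using inta by (auto simp: stationary_def d_def)
qed

lemma stationary_pos_part:
  assumes "stationary v"
  shows "stationary (\<lambda>x. max (v x) 0)"
proof -
  have "(\<lambda>x. max (v x) 0) = (\<lambda>x. 1/2 * v x + 1/2 * \<bar>v x\<bar>)" by auto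
  then show ?thesis using stationary_lincomb[OF assms stationary_abs[OF assms], of "1/2" "1/2"] by simp
qed

text \<open>At a point \<open>y\<close> with \<open>v y = 0\<close> the inflow is 0, although its
  integrand is nonnegative, so nothing flows to \<open>y\<close> from the set where \<open>v\<close>
  is positive. Irreducibility applies to that set.\<close>

lemma stationary_nonneg_dichotomy:
  assumes "stationary v" and nonneg: "\<And>x. 0 \<le> v x"
  shows "(AE x in M. v x = 0) \<or> (AE x in M. v x > 0)"
proof -
  have int: "integrable M v"
    and ae: "AE y in M. (\<integral>x. s x y * v x \<partial>M) = out_rate y * v y"
    using assms by (auto simp: stationary_def)
  have [measurable]: "v \<in> borel_measurable M" using int by simp
  define E where "E = {x \<in> space M. v x > 0}"
  have E: "E \<in> sets M" unfolding E_def by measurable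
  have "AE y in M. AE x in M. x \<in> E \<longrightarrow> y \<notin> E \<longrightarrow> s x y = 0"
    using ae AE_space
  proof eventually_elim
    case (elim y)
    show ?case
    proof (cases "y \<in> E")
      case False
      then have "v y = 0" using elim nonneg[of y] by (auto simp: E_def)
      then have "(\<integral>x. s x y * v x \<partial>M) = 0" using elim by simp
      then have "AE x in M. s x y * v x = 0"
        using integral_nonneg_eq_0_iff_AE[OF integrable_s_mult[OF int elim(2)]]
        by (auto simp: s_nonneg nonneg)
      then show ?thesis by eventually_elim (auto simp: E_def)
    qed simp
  qed
  \<comment> \<open>The balance equation yields exceptional sets of sources for a fixed target
    \<open>y\<close>, while irreducibility asks for exceptional targets for a fixed source;
    measurability of \<open>s\<close> and \<open>E\<close> allows the exchange.\<close>
  then have "AE x in M. AE y in M. x \<in> E \<longrightarrow> y \<notin> E \<longrightarrow> s x y = 0"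
    using E by (subst AE_commute) auto
  from irreducible[OF E this] show ?thesis
  proof
    assume "AE x in M. x \<in> E" then show ?thesis by (auto simp: E_def)
  next
    assume "AE x in M. x \<notin> E"
    then have "AE x in M. v x = 0"
      using AE_space by eventually_elim (use nonneg in \<open>auto simp: E_def not_less intro: antisym\<close>)
    then show ?thesis ..
  qed
qed

text \<open>The positive part of the difference \<open>u\<close> is stationary, so by the dichotomy
  \<open>u\<close> has a constant sign almost everywhere. Its integral is 0, hence \<open>u\<close>
  vanishes.\<close>

theorem stationary_unique:
  assumes v: "stationary v" "stationary w" and eq: "(\<integral>x. v x \<partial>M) = (\<integral>x. w x \<partial>M)"
  shows "AE x in M. v x = w x"
proof -
  define u where "u x = v x - w x" for x
  have "u = (\<lambda>x. 1 * v x + (- 1) * w x)" by (auto simp: u_def)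
  with stationary_lincomb[OF v, of 1 "- 1"] have u: "stationary u" by simp
  have int: "integrable M u" "(\<integral>x. u x \<partial>M) = 0"
    using u v eq by (simp_all add: u_def[abs_def] stationary_def)
  consider "AE x in M. max (u x) 0 = 0" | "AE x in M. max (u x) 0 > 0"
    using stationary_nonneg_dichotomy[OF stationary_pos_part[OF u]] by auto
  then have "AE x in M. u x = 0"
  proof cases
    case 1
    then have "AE x in M. 0 \<le> - u x" by eventually_elim (simp add: max_def split: if_splits)
    then have "AE x in M. - u x = 0"
      using integral_nonneg_eq_0_iff_AE[of M "\<lambda>x. - u x"] int by simp
    then show ?thesis by simp
  next
    case 2
    then have "AE x in M. 0 \<le> u x" by eventually_elim (simp add: max_def split: if_splits)
    then show ?thesis
      using integral_nonneg_eq_0_iff_AE[of M u] int by simp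
  qed
  then show ?thesis by (simp add: u_def)
qed

section \<open>The Markov operator and its invariant density\<close>

text \<open>The rate is at least \<delta> only almost everywhere. The maximum bounds the denominator
  from below everywhere and changes it only on a null set.\<close>

definition transition :: "'b \<Rightarrow> 'b \<Rightarrow> real" where
  "transition x y = s x y / max \<delta> (out_rate x)"

text \<open>The action of the chain on densities of the current state. With values in
  \<open>ennreal\<close>, Tonelli and upper limits need no integrability conditions.\<close>

definition push :: "('b \<Rightarrow> ennreal) \<Rightarrow> 'b \<Rightarrow> ennreal" where
  "push f y = (\<integral>\<^sup>+x. ennreal (transition x y) * f x \<partial>M)"

lemma measurable_transition [measurable]: "case_prod transition \<in> borel_measurable (M \<Otimes>\<^sub>M M)"
  unfolding transition_def by measurable

lemma measurable_push [measurable]: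
  assumes [measurable]: "f \<in> borel_measurable M"
  shows "push f \<in> borel_measurable M"
  unfolding push_def by measurable

lemma transition_nonneg: "0 \<le> transition x y"
  using s_nonneg[of x y] \<delta>_pos by (simp add: transition_def)

lemma transition_le: "transition x y \<le> c / \<delta>"
  unfolding transition_def using s_nonneg[of x y] s_le[of x y] \<delta>_pos c_nonneg by (intro frac_le) auto

lemma nn_integral_transition:
  "AE x in M. (\<integral>\<^sup>+y. ennreal (transition x y) \<partial>M) = 1"
  using \<delta>_le AE_space
proof eventually_elim
  case (elim x)
  have "(\<integral>\<^sup>+y. ennreal (transition x y) \<partial>M) = ennreal (\<integral>y. transition x y \<partial>M)"
    using integrable_s2[OF elim(2)] transition_nonneg
    by (intro nn_integral_eq_integral) (auto simp: transition_def)
  also have "(\<integral>y. transition x y \<partial>M) = 1"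
    using elim \<delta>_pos by (simp add: transition_def out_rate_def)
  finally show ?case by simp
qed

lemma nn_integral_push:
  assumes [measurable]: "f \<in> borel_measurable M"
  shows "(\<integral>\<^sup>+y. push f y \<partial>M) = (\<integral>\<^sup>+x. f x \<partial>M)"
proof -
  have "(\<integral>\<^sup>+y. push f y \<partial>M) = (\<integral>\<^sup>+x. \<integral>\<^sup>+y. ennreal (transition x y) * f x \<partial>M \<partial>M)"
    unfolding push_def by (rule Fubini') measurable
  also have "\<dots> = (\<integral>\<^sup>+x. (\<integral>\<^sup>+y. ennreal (transition x y) \<partial>M) * f x \<partial>M)"
    by (intro nn_integral_cong nn_integral_multc) measurable
  also have "\<dots> = (\<integral>\<^sup>+x. f x \<partial>M)"
    using nn_integral_transition by (intro nn_integral_cong_AE) (auto elim: eventually_mono)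
  finally show ?thesis .
qed

text \<open>One step of the chain smooths: the integral, which is conserved, bounds the next density
  uniformly. This provides the dominating constant for the reverse Fatou lemma.\<close>

lemma push_le:
  assumes [measurable]: "f \<in> borel_measurable M"
  shows "push f y \<le> ennreal (c / \<delta>) * (\<integral>\<^sup>+x. f x \<partial>M)"
proof -
  have "push f y \<le> (\<integral>\<^sup>+x. ennreal (c / \<delta>) * f x \<partial>M)"
    unfolding push_def by (intro nn_integral_mono mult_right_mono ennreal_leI transition_le) auto
  then show ?thesis by (simp add: nn_integral_cmult)
qed

text \<open>The upper limit of the iterates of \<^term>\<open>push\<close> on a constant is excessive by the reverse
  Fatou lemma, hence invariant, because \<^term>\<open>push\<close> preserves the integral.\<close>

lemma push_fixed_point:
  obtains g b where "g \<in> borel_measurable M" "\<And>x. g x \<le> ennreal b" "AE x in M. push g x = g x"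
    "(\<integral>\<^sup>+x. g x \<partial>M) \<noteq> 0"
proof -
  define f where "f n = (push ^^ n) (\<lambda>_. 1)" for n
  have f_Suc: "f (Suc n) = push (f n)" for n by (simp add: f_def)
  define g where "g x = limsup (\<lambda>n. f n x)" for x
  define m where "m = emeasure M (space M)"
  have m: "m < \<infinity>" "m \<noteq> 0"
    using emeasure_finite[of "space M"] space_nonnull by (auto simp: m_def less_top[symmetric])
  have f_meas [measurable]: "f n \<in> borel_measurable M" for n
    by (induction n) (auto simp: f_def)
  have g_meas [measurable]: "g \<in> borel_measurable M"
    unfolding g_def by measurable
  have f_int: "(\<integral>\<^sup>+x. f n x \<partial>M) = m" for n
  proof (induction n)
    case (Suc n)
    then show ?case using nn_integral_push[OF f_meas, of n] by (simp add: f_def)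
  qed (simp add: f_def m_def)
  \<comment> \<open>The maximum with 1 takes care of iterate 0; all later iterates obey
    \<open>push_le\<close> with the conserved integral \<open>m\<close>.\<close>
  define b where "b = max 1 (c / \<delta> * measure M (space M))"
  have f_le: "f n x \<le> ennreal b" for n x
  proof (cases n)
    case (Suc k)
    have "f n x \<le> ennreal (c / \<delta>) * m"
      using push_le[OF f_meas, of k x] by (simp add: f_int Suc) (simp add: f_def)
    also have "\<dots> = ennreal (c / \<delta> * measure M (space M))"
      using c_nonneg \<delta>_pos by (simp add: m_def emeasure_eq_measure flip: ennreal_mult)
    also have "\<dots> \<le> ennreal b" by (intro ennreal_leI) (simp add: b_def)
    finally show ?thesis .
  next
    case 0
    have "1 \<le> ennreal b" unfolding b_def by (subst ennreal_1[symmetric], intro ennreal_leI) simp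
    with 0 show ?thesis by (simp add: f_def)
  qed
  have g_le: "g x \<le> ennreal b" for x
    unfolding g_def by (intro Limsup_bounded always_eventually allI f_le)
  have b_fin: "(\<integral>\<^sup>+x. ennreal b \<partial>M) < \<infinity>"
    using m by (simp add: ennreal_mult_less_top m_def)
  have g_le_push: "g y \<le> push g y" if [measurable]: "y \<in> space M" for y
  proof -
    \<comment> \<open>For fixed \<open>y\<close>, \<open>push h y\<close> is the integral of
      \<open>h\<close> against \<open>?N\<close>, so the reverse Fatou lemma can be used for this
      measure.\<close>
    let ?N = "density M (\<lambda>x. ennreal (transition x y))"
    have dens: "(\<integral>\<^sup>+x. h x \<partial>?N) = push h y" if "h \<in> borel_measurable M" for h
      unfolding push_def using that by (intro nn_integral_density) measurable
    have "push (\<lambda>_. ennreal b) y \<le> ennreal (c / \<delta>) * (\<integral>\<^sup>+x. ennreal b \<partial>M)"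
      by (rule push_le) simp
    also have "\<dots> < \<infinity>" using b_fin by (simp add: ennreal_mult_less_top)
    finally have fin: "push (\<lambda>_. ennreal b) y < \<infinity>" .
    have "g y = limsup (\<lambda>n. f (Suc n) y)" unfolding g_def using limsup_shift[of "\<lambda>n. f n y"] by simp
    also have "\<dots> = limsup (\<lambda>n. \<integral>\<^sup>+x. f n x \<partial>?N)" by (simp only: dens[OF f_meas] f_Suc)
    also have "\<dots> \<le> (\<integral>\<^sup>+x. limsup (\<lambda>n. f n x) \<partial>?N)"
    proof (rule nn_integral_limsup[where w = "\<lambda>_. ennreal b"])
      show "(\<integral>\<^sup>+x. ennreal b \<partial>?N) < \<infinity>" using fin by (subst dens) simp_all
    qed (auto simp: f_le)
    also have "\<dots> = push g y" unfolding g_def[symmetric] by (rule dens) simp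
    finally show ?thesis .
  qed
  \<comment> \<open>Finiteness permits subtraction in \<open>ennreal\<close>: the nonnegative
    difference \<open>push g - g\<close> then has integral 0.\<close>
  have g_fin: "(\<integral>\<^sup>+x. g x \<partial>M) < \<infinity>"
    using b_fin nn_integral_mono[of M g "\<lambda>_. ennreal b"] g_le by (auto intro: le_less_trans)
  have "(\<integral>\<^sup>+x. push g x - g x \<partial>M) = (\<integral>\<^sup>+x. push g x \<partial>M) - (\<integral>\<^sup>+x. g x \<partial>M)"
    using g_fin g_le_push by (intro nn_integral_diff) auto
  also have "\<dots> = 0" using g_fin by (simp add: nn_integral_push)
  finally have "(\<integral>\<^sup>+x. push g x - g x \<partial>M) = 0" .
  then have "AE x in M. push g x - g x = 0"
    by (subst (asm) nn_integral_0_iff_AE) auto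
  then have "AE x in M. push g x = g x"
    using AE_space
  proof eventually_elim
    case (elim x)
    have "push g x \<le> g x" using elim(1) by (simp add: diff_eq_0_iff_ennreal)
    with g_le_push[OF elim(2)] show ?case by simp
  qed
  \<comment> \<open>Reverse Fatou again, now for \<open>M\<close> itself: the mass of the iterates
    is not lost in the upper limit.\<close>
  moreover have "m \<le> (\<integral>\<^sup>+x. g x \<partial>M)"
  proof -
    have "m = limsup (\<lambda>n. \<integral>\<^sup>+x. f n x \<partial>M)" by (simp add: f_int Limsup_const)
    also have "\<dots> \<le> (\<integral>\<^sup>+x. g x \<partial>M)"
      unfolding g_def using b_fin
      by (intro nn_integral_limsup[where w = "\<lambda>_. ennreal b"]) (auto simp: f_le)
    finally show ?thesis .
  qed
  ultimately show ?thesis using g_meas g_le m(2) by (intro that[of g b]) auto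
qed

text \<open>The upper bound \<open>b\<close> is part of the conclusion because it places
  \<open>v\<close> in \<open>L2\<close> later on.\<close>

theorem stationary_exists:
  obtains v b where "stationary v" "AE x in M. 0 < v x" "AE x in M. v x \<le> b" "(\<integral>x. v x \<partial>M) = 1"
proof -
  obtain g b where g [measurable]: "g \<in> borel_measurable M" and g_le: "\<And>x. g x \<le> ennreal b"
    and fix_g: "AE x in M. push g x = g x" and g0: "(\<integral>\<^sup>+x. g x \<partial>M) \<noteq> 0"
    using push_fixed_point by blast
  define h where "h x = enn2real (g x)" for x
  have g_eq: "g x = ennreal (h x)" for x
    using le_less_trans[OF g_le[of x] ennreal_less_top] by (simp add: h_def)
  have h [measurable]: "h \<in> borel_measurable M" unfolding h_def by measurable
  have h_nonneg: "0 \<le> h x" for x by (simp add: h_def)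
  have h_le: "h x \<le> \<bar>b\<bar>" for x
    unfolding h_def by (intro enn2real_leI order_trans[OF g_le] ennreal_leI) auto
  \<comment> \<open>The same truncated rate as in \<open>transition\<close>, so that
    \<open>s x y * v x = transition x y * h x\<close> holds at every point.\<close>
  define r where "r x = max \<delta> (out_rate x)" for x
  have r [measurable]: "r \<in> borel_measurable M" and r_ge: "\<delta> \<le> r x" for x
    unfolding r_def by auto
  have r_pos: "0 < r x" for x using r_ge[of x] \<delta>_pos by simp
  define v where "v x = h x / r x" for x
  have [measurable]: "v \<in> borel_measurable M" unfolding v_def by measurable
  have v_nonneg: "0 \<le> v x" and v_le: "v x \<le> \<bar>b\<bar> / \<delta>" for x
    unfolding v_def using h_nonneg[of x] h_le[of x] r_ge[of x] \<delta>_pos by (auto intro!: frac_le)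
  have int: "integrable M v"
    by (rule integrable_const_bound[where B = "\<bar>b\<bar> / \<delta>"]) (use v_nonneg v_le in auto)
  have "AE y in M. (\<integral>x. s x y * v x \<partial>M) = out_rate y * v y"
    using fix_g \<delta>_le AE_space
  proof eventually_elim
    case (elim y)
    have eq: "s x y * v x = transition x y * h x" for x
      by (simp add: v_def r_def transition_def)
    have "ennreal (h y) = (\<integral>\<^sup>+x. ennreal (transition x y * h x) \<partial>M)"
      using elim(1) by (simp add: push_def g_eq ennreal_mult transition_nonneg h_nonneg)
    also have "\<dots> = ennreal (\<integral>x. s x y * v x \<partial>M)"
      using integrable_s_mult[OF int elim(3)] transition_nonneg h_nonneg
      by (subst nn_integral_eq_integral) (auto simp: eq)
    finally have "h y = (\<integral>x. s x y * v x \<partial>M)"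
      using h_nonneg s_nonneg v_nonneg by (subst (asm) ennreal_inj) auto
    moreover have "out_rate y * v y = h y"
      using elim(2) \<delta>_pos by (simp add: v_def r_def out_rate_def)
    ultimately show ?case by simp
  qed
  with int have stat: "stationary v" by (simp add: stationary_def)
  \<comment> \<open>The nonzero integral of \<open>g\<close> excludes the trivial alternative of the
    dichotomy.\<close>
  have "\<not> (AE x in M. v x = 0)"
  proof
    assume "AE x in M. v x = 0"
    then have "AE x in M. g x = 0"
      by eventually_elim (use r_pos in \<open>auto simp: v_def g_eq less_le\<close>)
    then show False using g0 by (simp add: nn_integral_0_iff_AE)
  qed
  with stationary_nonneg_dichotomy[OF stat v_nonneg] have pos: "AE x in M. 0 < v x" by blast
  define I where "I = (\<integral>x. v x \<partial>M)"
  have "I \<noteq> 0"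
  proof
    assume "I = 0"
    then have "AE x in M. v x = 0"
      using integral_nonneg_eq_0_iff_AE[OF int] v_nonneg by (simp add: I_def)
    with \<open>\<not> (AE x in M. v x = 0)\<close> show False by simp
  qed
  moreover have "0 \<le> I" unfolding I_def by (simp add: v_nonneg)
  ultimately have "0 < I" by simp
  show ?thesis
  proof (rule that)
    show "stationary (\<lambda>x. v x / I)"
      using stationary_lincomb[OF stat stat, of "1 / I" 0] by simp
    show "AE x in M. 0 < v x / I" using pos by eventually_elim (use \<open>0 < I\<close> in simp)
    show "AE x in M. v x / I \<le> \<bar>b\<bar> / \<delta> / I"
      using v_le \<open>0 < I\<close> by (intro AE_I2 divide_right_mono) auto
    show "(\<integral>x. v x / I \<partial>M) = 1" using \<open>0 < I\<close> by (simp add: I_def)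
  qed
qed

end

section \<open>Interaction matrices\<close>

lemma strongly_connected_propagate:
  assumes "strongly_connected V E" and "i \<in> V" "j \<in> V" "P i"
    and step: "\<And>x y. x \<in> V \<Longrightarrow> y \<in> V \<Longrightarrow> E x y \<Longrightarrow> P x \<Longrightarrow> P y"
  shows "P j"
proof (cases "i = j")
  case False
  then obtain r p where p: "p 0 = i" "p r = j" "\<forall>k\<le>r. p k \<in> V" "\<forall>k<r. E (p k) (p (Suc k))"
    using assms(1-3) unfolding strongly_connected_def by blast
  have "P (p k)" if "k \<le> r" for k
    using that
  proof (induction k)
    case (Suc k)
    then show ?case using p step[of "p k" "p (Suc k)"] by simp
  qed (use p \<open>P i\<close> in simp)
  then show ?thesis using p(2) by blast
qed (use \<open>P i\<close> in simp)

lemma constant_on_nonneg_reals: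
  fixes f :: "real \<Rightarrow> real"
  assumes "\<And>t. t \<ge> 0 \<Longrightarrow> (f has_real_derivative 0) (at t within {0..})"
    and "0 \<le> t" "0 \<le> t'"
  shows "f t = f t'"
proof -
  have "\<exists>c. \<forall>x\<in>{0..}. f x = c"
  proof (rule has_derivative_zero_constant)
    show "(f has_derivative (\<lambda>h. 0)) (at x within {0..})" if "x \<in> {0..}" for x
    proof -
      have "(*) 0 = (\<lambda>h::real. 0 :: real)" by auto
      then show ?thesis using assms(1)[of x] that by (simp add: has_field_derivative_def)
    qed
  qed simp
  then show ?thesis using assms(2,3) by auto
qed

lemma transpose_interaction_matrix_mult:
  "(transpose (interaction_matrix s) *v v) $ j =
     (\<Sum>i\<in>UNIV - {j}. s $ i $ j * v $ i) - (\<Sum>k\<in>UNIV - {j}. s $ j $ k) * v $ j"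
proof -
  have "(transpose (interaction_matrix s) *v v) $ j = (\<Sum>i\<in>UNIV. interaction_matrix s $ i $ j * v $ i)"
    by (simp add: matrix_vector_mult_def transpose_def)
  also have "\<dots> = interaction_matrix s $ j $ j * v $ j
      + (\<Sum>i\<in>UNIV - {j}. interaction_matrix s $ i $ j * v $ i)"
    by (rule sum.remove) auto
  also have "(\<Sum>i\<in>UNIV - {j}. interaction_matrix s $ i $ j * v $ i) = (\<Sum>i\<in>UNIV - {j}. s $ i $ j * v $ i)"
    by (rule sum.cong) (auto simp: interaction_matrix_def)
  finally show ?thesis by (simp add: interaction_matrix_def)
qed

text \<open>The diagonal entries of the interaction matrix do not affect the operator. Setting them to 1
  bounds the outflow rates from below, also when there is a single vertex.\<close>

theorem matrix_normalized_kernel_vector: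
  fixes s :: "real^'n^'n"
  assumes s: "\<And>i j. 0 \<le> s $ i $ j" and conn: "matrix_graph_strongly_connected s"
  shows "\<exists>!v. normalized_kernel_vector s v"
proof -
  define s' where "s' i j = (if i = j then 1 else s $ i $ j)" for i j
  \<comment> \<open>The double sum dominates every entry of \<open>s\<close>, and the summand 1
    covers the new diagonal.\<close>
  define c where "c = 1 + (\<Sum>i\<in>UNIV. \<Sum>j\<in>UNIV. s $ i $ j)"
  have s_le: "s $ i $ j \<le> (\<Sum>i\<in>UNIV. \<Sum>j\<in>UNIV. s $ i $ j)" for i j
  proof -
    have "s $ i $ j \<le> (\<Sum>j\<in>UNIV. s $ i $ j)"
      using s by (intro member_le_sum) auto
    also have "\<dots> \<le> (\<Sum>i\<in>UNIV. \<Sum>j\<in>UNIV. s $ i $ j)"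
      using s by (intro member_le_sum[where f = "\<lambda>i. \<Sum>j\<in>UNIV. s $ i $ j"] sum_nonneg) auto
    finally show ?thesis .
  qed
  let ?M = "count_space (UNIV :: 'n set)"
  interpret irreducible_kernel ?M s' c 1
  proof
    show "case_prod s' \<in> borel_measurable (?M \<Otimes>\<^sub>M ?M)"
      by (simp add: pair_measure_countable)
    show "0 \<le> s' i j" "s' i j \<le> c" for i j
      using s s_le[of i j] order_trans[OF s s_le[of i j]] by (auto simp: s'_def c_def add_increasing)
    show "AE i in ?M. 1 \<le> (\<integral>j. s' i j \<partial>?M)"
    proof (rule AE_I2)
      fix i :: 'n
      have "s' i i \<le> (\<Sum>j\<in>UNIV. s' i j)"
        by (rule member_le_sum) (auto simp: s'_def s)
      then show "1 \<le> (\<integral>j. s' i j \<partial>?M)"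
        by (simp add: lebesgue_integral_count_space_finite s'_def)
    qed
    fix E :: "'n set"
    assume E: "AE i in ?M. AE j in ?M. i \<in> E \<longrightarrow> j \<notin> E \<longrightarrow> s' i j = 0"
    have "j \<in> E" if "i \<in> E" for i j
    proof (rule strongly_connected_propagate[OF conn[unfolded matrix_graph_strongly_connected_def]])
      \<comment> \<open>If \<open>y\<close> were outside \<open>E\<close>, then
        \<open>x \<noteq> y\<close>, so the entry is off the diagonal and \<open>s'\<close> agrees
        there with \<open>s\<close>.\<close>
      fix x y assume "0 < s $ x $ y" "x \<in> E"
      then show "y \<in> E" using E by (force simp: AE_count_space s'_def split: if_splits)
    qed (use that in auto)
    then show "(AE x in ?M. x \<in> E) \<or> (AE x in ?M. x \<notin> E)"
      by (auto simp: AE_count_space)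
  qed (auto simp: emeasure_count_space)
  have int: "(\<integral>i. f i \<partial>?M) = (\<Sum>i\<in>UNIV. f i)" for f :: "'n \<Rightarrow> real"
    by (simp add: lebesgue_integral_count_space_finite)
  have stat: "stationary f \<longleftrightarrow> transpose (interaction_matrix s) *v (\<chi> i. f i) = 0" for f
  proof -
    \<comment> \<open>The diagonal 1 adds \<open>f j\<close> both to the inflow and to the outflow,
      and cancels.\<close>
    have "(\<Sum>i\<in>UNIV. s' i j * f i) - out_rate j * f j
        = (transpose (interaction_matrix s) *v (\<chi> i. f i)) $ j" for j
    proof -
      have "(\<Sum>i\<in>UNIV. s' i j * f i) = s' j j * f j + (\<Sum>i\<in>UNIV - {j}. s' i j * f i)"
        by (rule sum.remove) auto
      also have "(\<Sum>i\<in>UNIV - {j}. s' i j * f i) = (\<Sum>i\<in>UNIV - {j}. s $ i $ j * f i)"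
        by (rule sum.cong) (auto simp: s'_def)
      finally have 1: "(\<Sum>i\<in>UNIV. s' i j * f i) = f j + (\<Sum>i\<in>UNIV - {j}. s $ i $ j * f i)"
        by (simp add: s'_def)
      have "out_rate j = s' j j + (\<Sum>k\<in>UNIV - {j}. s' j k)"
        unfolding out_rate_def int by (rule sum.remove) auto
      also have "(\<Sum>k\<in>UNIV - {j}. s' j k) = (\<Sum>k\<in>UNIV - {j}. s $ j $ k)"
        by (rule sum.cong) (auto simp: s'_def)
      finally have 2: "out_rate j = 1 + (\<Sum>k\<in>UNIV - {j}. s $ j $ k)"
        by (simp add: s'_def[of j j])
      show ?thesis
        unfolding transpose_interaction_matrix_mult 1 2 by (simp add: algebra_simps)
    qed
    then have "transpose (interaction_matrix s) *v (\<chi> i. f i) = 0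
        \<longleftrightarrow> (\<forall>j. (\<Sum>i\<in>UNIV. s' i j * f i) - out_rate j * f j = 0)"
      by (simp only: vec_eq_iff zero_index)
    moreover have "stationary f \<longleftrightarrow> (\<forall>j. (\<Sum>i\<in>UNIV. s' i j * f i) = out_rate j * f j)"
      by (simp only: stationary_def AE_count_space int) (simp add: integrable_count_space)
    ultimately show ?thesis by simp
  qed
  have ones: "v \<bullet> ones = (\<integral>i. v $ i \<partial>?M)" for v :: "real^'n"
    by (simp add: inner_vec_def ones_def int)
  obtain v b where v: "stationary v" "AE x in ?M. 0 < v x" "(\<integral>x. v x \<partial>?M) = 1"
    using stationary_exists by blast
  show ?thesis
  proof
    show "normalized_kernel_vector s (\<chi> i. v i)"
      using v by (simp add: normalized_kernel_vector_def stat ones AE_count_space)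
    fix w assume w: "normalized_kernel_vector s w"
    then have "stationary (\<lambda>i. w $ i)" "(\<integral>i. w $ i \<partial>?M) = 1"
      by (auto simp: normalized_kernel_vector_def stat ones)
    from stationary_unique[OF this(1) v(1)] this(2) v(3) show "w = (\<chi> i. v i)"
      by (simp add: AE_count_space vec_eq_iff)
  qed
qed

text \<open>Moving the matrix to the other side of the inner product turns the derivative of
  \<open>y t \<bullet> v\<close> into the inner product of \<open>y t\<close> with the transpose
  applied to \<open>v\<close>, which is 0.\<close>

theorem matrix_weighted_mean_constant:
  assumes "transpose (interaction_matrix s) *v v = 0" and y: "cauchy_solution s yin y"
    and "0 \<le> t" "0 \<le> t'"
  shows "weighted_mean v (y t) = weighted_mean v (y t')"
proof -
  have "((\<lambda>t. y t \<bullet> v) has_real_derivative 0) (at t within {0..})" if "t \<ge> 0" for t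
  proof -
    have "((\<lambda>t. y t \<bullet> v) has_vector_derivative (interaction_matrix s *v y t) \<bullet> v) (at t within {0..})"
      using y that unfolding cauchy_solution_def
      by (intro bounded_linear.has_vector_derivative[OF bounded_linear_inner_left]) auto
    moreover have "(interaction_matrix s *v y t) \<bullet> v = 0"
      using assms(1) dot_lmul_matrix[of v "interaction_matrix s" "y t"]
      by (simp add: inner_commute flip: vector_transpose_matrix)
    ultimately show ?thesis by (simp add: has_real_derivative_iff_has_vector_derivative)
  qed
  from constant_on_nonneg_reals[OF this assms(3,4)] show ?thesis
    by (simp add: weighted_mean_def)
qed

section \<open>Square-integrable functions and kernel operators\<close>

lemma AE_lebesgue_on_iff:
  assumes "S \<in> sets lebesgue"
  shows "(AE x in lebesgue_on S. P x) \<longleftrightarrow> (AE x in lebesgue. x \<in> S \<longrightarrow> P x)"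
  using assms by (subst AE_restrict_space_iff) auto

text \<open>Lebesgue measure is the completion of \<open>lborel\<close> and has the same almost
  everywhere statements; for \<open>lborel\<close> the measure on the product space is the product
  measure.\<close>

lemma AE_lebesgue_pair:
  fixes P :: "'a::euclidean_space \<times> 'b::euclidean_space \<Rightarrow> bool"
  assumes "AE p in lebesgue. P p"
  shows "AE x in lebesgue. AE y in lebesgue. P (x, y)"
proof -
  have "AE p in lborel \<Otimes>\<^sub>M lborel. P p"
    using assms by (subst lborel_prod) (simp add: AE_completion_iff)
  then have "AE x in lborel. AE y in lborel. P (x, y)"
    by (rule lborel_pair.AE_pair)
  then show ?thesis by (simp add: AE_completion_iff)
qed

lemma AE_lebesgue_on_pair:
  fixes P :: "'a::euclidean_space \<times> 'b::euclidean_space \<Rightarrow> bool"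
  assumes "AE p in lebesgue_on (S \<times> T). P p"
    and "S \<in> sets lebesgue" "T \<in> sets lebesgue" "S \<times> T \<in> sets lebesgue"
  shows "AE x in lebesgue_on S. AE y in lebesgue_on T. P (x, y)"
proof -
  have "AE x in lebesgue. AE y in lebesgue. (x, y) \<in> S \<times> T \<longrightarrow> P (x, y)"
    using assms by (intro AE_lebesgue_pair) (simp add: AE_lebesgue_on_iff)
  then show ?thesis
    unfolding AE_lebesgue_on_iff[OF assms(2)] AE_lebesgue_on_iff[OF assms(3)]
  proof eventually_elim
    case (elim x)
    show ?case
    proof
      assume "x \<in> S"
      show "AE y in lebesgue. y \<in> T \<longrightarrow> P (x, y)"
        using elim by eventually_elim (use \<open>x \<in> S\<close> in simp)
    qed
  qed
qed

text \<open>Completeness of Lebesgue measure. Sections of \<sigma> and images under the interaction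
  operator inherit measurability in this way from their counterparts for a Borel kernel.\<close>

lemma borel_measurable_lebesgue_on_AE:
  fixes f g :: "'a::euclidean_space \<Rightarrow> real"
  assumes f: "f \<in> borel_measurable (lebesgue_on S)" and S: "S \<in> sets lebesgue"
    and ae: "AE x in lebesgue_on S. f x = g x"
  shows "g \<in> borel_measurable (lebesgue_on S)"
proof (rule borel_measurable_if_D, rule borel_measurable_AE)
  show "(\<lambda>x. if x \<in> S then f x else 0) \<in> borel_measurable lebesgue"
    using f S by (simp add: borel_measurable_if)
  show "AE x in lebesgue. (if x \<in> S then f x else 0) = (if x \<in> S then g x else 0)"
    using ae unfolding AE_lebesgue_on_iff[OF S] by eventually_elim simp
qed

lemma integral_lebesgue_on_cong_AE:
  fixes f g :: "'a::euclidean_space \<Rightarrow> real"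
  assumes f: "f \<in> borel_measurable (lebesgue_on S)" and S: "S \<in> sets lebesgue"
    and ae: "AE x in lebesgue_on S. f x = g x"
  shows "(\<integral>x. f x \<partial>lebesgue_on S) = (\<integral>x. g x \<partial>lebesgue_on S)"
  using f borel_measurable_lebesgue_on_AE[OF f S ae] ae by (rule integral_cong_AE)

text \<open>A section of a Lebesgue measurable function can fail to be measurable at exceptional
  points, but every section of a Borel function is measurable. Clipping makes the bounds hold
  everywhere.\<close>

lemma interaction_function_borel_representative:
  fixes \<sigma> :: "'a::euclidean_space \<times> 'a \<Rightarrow> real"
  assumes "interaction_function \<Omega> \<sigma>" and "open \<Omega>"
  obtains \<tau> c where "\<tau> \<in> borel_measurable borel" "\<And>p. 0 \<le> \<tau> p" "\<And>p. \<tau> p \<le> c"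
    "AE p in lebesgue_on (\<Omega> \<times> \<Omega>). \<sigma> p = \<tau> p"
proof -
  have [simp]: "\<Omega> \<times> \<Omega> \<in> sets lebesgue" using assms(2) by (simp add: open_Times)
  obtain c where meas: "\<sigma> \<in> borel_measurable (lebesgue_on (\<Omega> \<times> \<Omega>))"
    and bd: "AE p in lebesgue_on (\<Omega> \<times> \<Omega>). \<bar>\<sigma> p\<bar> \<le> c" and nn: "AE p in lebesgue_on (\<Omega> \<times> \<Omega>). 0 \<le> \<sigma> p"
    using assms unfolding interaction_function_def by blast
  have "(\<lambda>p. if p \<in> \<Omega> \<times> \<Omega> then \<sigma> p else 0) \<in> borel_measurable lebesgue"
    using meas by (simp only: borel_measurable_if \<open>\<Omega> \<times> \<Omega> \<in> sets lebesgue\<close>)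
  from completion_ex_borel_measurable_real[OF this] obtain \<sigma>' where
    \<sigma>': "\<sigma>' \<in> borel_measurable lborel" "AE p in lborel. (if p \<in> \<Omega> \<times> \<Omega> then \<sigma> p else 0) = \<sigma>' p"
    by blast
  have eq: "AE p in lebesgue_on (\<Omega> \<times> \<Omega>). \<sigma> p = \<sigma>' p"
    unfolding AE_lebesgue_on_iff[OF \<open>\<Omega> \<times> \<Omega> \<in> sets lebesgue\<close>]
    using AE_completion[OF \<sigma>'(2)] by eventually_elim auto
  show ?thesis
  \<comment> \<open>The absolute value ensures that the clipping interval from 0 to the bound is
    nonempty.\<close>
  proof (rule that[of _ "\<bar>c\<bar>"])
    show "(\<lambda>p. max 0 (min \<bar>c\<bar> (\<sigma>' p))) \<in> borel_measurable borel"
      using \<sigma>'(1) by simp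
    show "AE p in lebesgue_on (\<Omega> \<times> \<Omega>). \<sigma> p = max 0 (min \<bar>c\<bar> (\<sigma>' p))"
      using eq bd nn by eventually_elim auto
  qed auto
qed

section \<open>Inner product and Cauchy-Schwarz inequality for representatives\<close>

lemma L2_mult_integrable:
  assumes "f \<in> L2 \<Omega>" "g \<in> L2 \<Omega>"
  shows "integrable (lebesgue_on \<Omega>) (\<lambda>x. f x * g x)"
proof (rule Bochner_Integration.integrable_bound)
  show "integrable (lebesgue_on \<Omega>) (\<lambda>x. (f x)\<^sup>2 + (g x)\<^sup>2)"
    using assms by (simp add: L2_def)
  show "AE x in lebesgue_on \<Omega>. norm (f x * g x) \<le> norm ((f x)\<^sup>2 + (g x)\<^sup>2)"
  proof (rule AE_I2)
    fix x
    have "0 \<le> (\<bar>f x\<bar> - \<bar>g x\<bar>)\<^sup>2" by simp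
    then have "2 * (\<bar>f x\<bar> * \<bar>g x\<bar>) \<le> (f x)\<^sup>2 + (g x)\<^sup>2"
      by (simp add: power2_diff)
    moreover have "0 \<le> \<bar>f x\<bar> * \<bar>g x\<bar>" by simp
    ultimately show "norm (f x * g x) \<le> norm ((f x)\<^sup>2 + (g x)\<^sup>2)"
      unfolding real_norm_def abs_mult by linarith
  qed
qed (use assms in \<open>auto simp: L2_def\<close>)

lemma L2_lincomb:
  assumes "f \<in> L2 \<Omega>" "g \<in> L2 \<Omega>"
  shows "(\<lambda>x. a * f x + b * g x) \<in> L2 \<Omega>"
proof -
  have "integrable (lebesgue_on \<Omega>) (\<lambda>x. a\<^sup>2 * (f x)\<^sup>2 + b\<^sup>2 * (g x)\<^sup>2 + 2 * a * b * (f x * g x))"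
    using assms L2_mult_integrable[OF assms] by (simp add: L2_def)
  also have "(\<lambda>x. a\<^sup>2 * (f x)\<^sup>2 + b\<^sup>2 * (g x)\<^sup>2 + 2 * a * b * (f x * g x)) = (\<lambda>x. (a * f x + b * g x)\<^sup>2)"
    by (simp add: power2_eq_square algebra_simps)
  finally show ?thesis using assms by (auto simp: L2_def intro!: borel_measurable_add borel_measurable_times)
qed

lemma L2_diff: "f \<in> L2 \<Omega> \<Longrightarrow> g \<in> L2 \<Omega> \<Longrightarrow> (\<lambda>x. f x - g x) \<in> L2 \<Omega>"
  using L2_lincomb[of f \<Omega> g 1 "- 1"] by simp

lemma L2_inner_lincomb_left:
  assumes "f \<in> L2 \<Omega>" "g \<in> L2 \<Omega>" "h \<in> L2 \<Omega>"
  shows "L2_inner \<Omega> (\<lambda>x. a * f x + b * g x) h = a * L2_inner \<Omega> f h + b * L2_inner \<Omega> g h"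
proof -
  have "L2_inner \<Omega> (\<lambda>x. a * f x + b * g x) h = (\<integral>x. a * (f x * h x) + b * (g x * h x) \<partial>lebesgue_on \<Omega>)"
    by (simp add: L2_inner_def algebra_simps)
  then show ?thesis
    using L2_mult_integrable[OF assms(1,3)] L2_mult_integrable[OF assms(2,3)] by (simp add: L2_inner_def)
qed

lemma L2_inner_commute: "L2_inner \<Omega> f g = L2_inner \<Omega> g f"
  by (simp add: L2_inner_def mult.commute)

lemma L2_inner_diff_left:
  assumes "f \<in> L2 \<Omega>" "g \<in> L2 \<Omega>" "h \<in> L2 \<Omega>"
  shows "L2_inner \<Omega> (\<lambda>x. f x - g x) h = L2_inner \<Omega> f h - L2_inner \<Omega> g h"
  using L2_inner_lincomb_left[OF assms, of 1 "- 1"] by simp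

lemma L2_inner_self_nonneg: "0 \<le> L2_inner \<Omega> f f"
  by (simp add: L2_inner_def)

lemma L2_inner_self_eq_0:
  assumes "f \<in> L2 \<Omega>" "L2_inner \<Omega> f f = 0"
  shows "AE x in lebesgue_on \<Omega>. f x = 0"
proof -
  have "AE x in lebesgue_on \<Omega>. f x * f x = 0"
    using integral_nonneg_eq_0_iff_AE[OF L2_mult_integrable[OF assms(1) assms(1)]] assms(2)
    by (simp add: L2_inner_def)
  then show ?thesis by simp
qed

lemma L2_inner_cong_AE:
  assumes "f \<in> L2 \<Omega>" "f' \<in> borel_measurable (lebesgue_on \<Omega>)" "g \<in> L2 \<Omega>"
    and "AE x in lebesgue_on \<Omega>. f x = f' x"
  shows "L2_inner \<Omega> f g = L2_inner \<Omega> f' g"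
  unfolding L2_inner_def
proof (rule integral_cong_AE)
  show "AE x in lebesgue_on \<Omega>. f x * g x = f' x * g x"
    using assms(4) by eventually_elim simp
qed (use assms in \<open>auto simp: L2_def\<close>)

lemma L2_Cauchy_Schwarz:
  assumes f: "f \<in> L2 \<Omega>" and g: "g \<in> L2 \<Omega>"
  shows "\<bar>L2_inner \<Omega> f g\<bar> \<le> L2_norm \<Omega> f * L2_norm \<Omega> g"
proof -
  define a b p where "a = L2_inner \<Omega> f f" and "b = L2_inner \<Omega> g g" and "p = L2_inner \<Omega> f g"
  have "a \<ge> 0" unfolding a_def by (rule L2_inner_self_nonneg)
  have "p\<^sup>2 \<le> a * b"
  proof (cases "a = 0")
    case True
    then have "AE x in lebesgue_on \<Omega>. f x = 0" using f by (simp add: a_def L2_inner_self_eq_0)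
    then have "L2_inner \<Omega> f g = L2_inner \<Omega> (\<lambda>_. 0) g"
      using f g by (intro L2_inner_cong_AE) auto
    with True show ?thesis by (simp add: p_def L2_inner_def)
  next
    case False
    \<comment> \<open>\<open>a\<close> times the component of \<open>g\<close> orthogonal to
      \<open>f\<close>; its squared norm is \<open>a * (a * b - p\<^sup>2)\<close>.\<close>
    define h where "h = (\<lambda>x. a * g x + (- p) * f x)"
    have h: "h \<in> L2 \<Omega>" unfolding h_def by (intro L2_lincomb f g)
    have "0 \<le> L2_inner \<Omega> h h" by (rule L2_inner_self_nonneg)
    also have "L2_inner \<Omega> h h = a * L2_inner \<Omega> g h + (- p) * L2_inner \<Omega> f h"
      by (subst (1) h_def, rule L2_inner_lincomb_left[OF g f h])
    also have "L2_inner \<Omega> g h = a * b + (- p) * p"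
      unfolding L2_inner_commute[of \<Omega> g] unfolding h_def L2_inner_lincomb_left[OF g f g]
      by (simp add: b_def p_def L2_inner_commute)
    also have "L2_inner \<Omega> f h = a * p + (- p) * a"
      unfolding L2_inner_commute[of \<Omega> f] unfolding h_def L2_inner_lincomb_left[OF g f f]
      by (simp add: a_def p_def L2_inner_commute)
    finally have "0 \<le> a * (a * b - p\<^sup>2)" by (simp add: algebra_simps power2_eq_square)
    with False \<open>a \<ge> 0\<close> show ?thesis by (simp add: zero_le_mult_iff)
  qed
  then have "sqrt (p\<^sup>2) \<le> sqrt (a * b)" by (rule real_sqrt_le_mono)
  then show ?thesis by (simp add: L2_norm_def a_def b_def p_def real_sqrt_mult)
qed

section \<open>Integral operators with a bounded Borel kernel, and their adjoints\<close>

locale L2_kernel_operator =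
  fixes \<Omega> :: "'a::euclidean_space set" and \<tau> :: "'a \<times> 'a \<Rightarrow> real" and c :: real
  assumes open_dom: "open \<Omega>" and bounded_dom: "bounded \<Omega>"
    and measurable_\<tau> [measurable]: "\<tau> \<in> borel_measurable borel"
    and \<tau>_nonneg: "0 \<le> \<tau> p" and \<tau>_le: "\<tau> p \<le> c"
begin

abbreviation "L \<equiv> lebesgue_on \<Omega>"

lemma dom_lebesgue: "\<Omega> \<in> sets lebesgue" "\<Omega> \<times> \<Omega> \<in> sets lebesgue"
  using open_dom by (auto simp: open_Times)

sublocale finite_measure L
  by (intro finite_measure_lebesgue_on lmeasurable_open bounded_dom open_dom)

sublocale pair_sigma_finite L L ..

lemma measurable_pair_\<tau> [measurable]: "(\<lambda>(x, y). \<tau> (x, y)) \<in> borel_measurable (L \<Otimes>\<^sub>M L)"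
proof -
  have id: "(\<lambda>x. x) \<in> L \<rightarrow>\<^sub>M borel"
    by (intro measurable_restrict_space1 measurable_completion) simp
  have "(\<lambda>p. (fst p, snd p)) \<in> L \<Otimes>\<^sub>M L \<rightarrow>\<^sub>M borel \<Otimes>\<^sub>M borel"
    by (intro measurable_Pair measurable_compose[OF measurable_fst id] measurable_compose[OF measurable_snd id])
  then have "(\<lambda>p. (fst p, snd p)) \<in> L \<Otimes>\<^sub>M L \<rightarrow>\<^sub>M borel" by (simp add: borel_prod)
  from measurable_compose[OF this measurable_\<tau>] show ?thesis by (simp add: case_prod_beta)
qed

lemma measurable_\<tau>1 [measurable]: "y \<in> \<Omega> \<Longrightarrow> (\<lambda>x. \<tau> (x, y)) \<in> borel_measurable L"
  using measurable_compose[OF measurable_Pair2'[of y L L] measurable_pair_\<tau>] by simp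

lemma measurable_\<tau>2 [measurable]: "x \<in> \<Omega> \<Longrightarrow> (\<lambda>y. \<tau> (x, y)) \<in> borel_measurable L"
  using measurable_compose[OF measurable_Pair1'[of x L L] measurable_pair_\<tau>] by simp

lemma c_nonneg: "0 \<le> c" using \<tau>_nonneg \<tau>_le by (rule order_trans)

lemma L2_integrable: "f \<in> L2 \<Omega> \<Longrightarrow> integrable L f"
  by (rule square_integrable_imp_integrable) (auto simp: L2_def)

lemma L2_bounded:
  assumes [measurable]: "f \<in> borel_measurable L" and bd: "AE x in L. \<bar>f x\<bar> \<le> b"
  shows "f \<in> L2 \<Omega>"
proof -
  have "integrable L (\<lambda>x. (f x)\<^sup>2)"
  proof (rule integrable_const_bound)
    show "AE x in L. norm ((f x)\<^sup>2) \<le> b\<^sup>2"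
      using bd
    proof eventually_elim
      fix x assume "\<bar>f x\<bar> \<le> b"
      then show "norm ((f x)\<^sup>2) \<le> b\<^sup>2" using power_mono[of "\<bar>f x\<bar>" b 2] by simp
    qed
  qed measurable
  then show ?thesis by (simp add: L2_def)
qed

lemma L2_bounded_mult:
  assumes [measurable]: "h \<in> borel_measurable L" and bd: "AE x in L. \<bar>h x\<bar> \<le> b" and f: "f \<in> L2 \<Omega>"
  shows "(\<lambda>x. h x * f x) \<in> L2 \<Omega>"
proof -
  have [measurable]: "f \<in> borel_measurable L" using f by (simp add: L2_def)
  have "integrable L (\<lambda>x. (h x * f x)\<^sup>2)"
  proof (rule Bochner_Integration.integrable_bound)
    show "integrable L (\<lambda>x. b\<^sup>2 * (f x)\<^sup>2)" using f by (simp add: L2_def)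
    show "AE x in L. norm ((h x * f x)\<^sup>2) \<le> norm (b\<^sup>2 * (f x)\<^sup>2)"
      using bd
    proof (eventually_elim)
      fix x assume "\<bar>h x\<bar> \<le> b"
      then have "(h x)\<^sup>2 \<le> b\<^sup>2" using power_mono[of "\<bar>h x\<bar>" b 2] by simp
      then show "norm ((h x * f x)\<^sup>2) \<le> norm (b\<^sup>2 * (f x)\<^sup>2)"
        by (simp add: power_mult_distrib mult_right_mono)
    qed
  qed measurable
  then show ?thesis by (simp add: L2_def)
qed

lemma integrable_\<tau>_mult:
  assumes "integrable L f" "x \<in> \<Omega>"
  shows "integrable L (\<lambda>y. \<tau> (x, y) * f y)" "integrable L (\<lambda>y. \<tau> (y, x) * f y)"
proof -
  have [measurable]: "f \<in> borel_measurable L" using assms by simp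
  have "integrable L (\<lambda>y. h y * f y)" if [measurable]: "h \<in> borel_measurable L" and "\<And>y. 0 \<le> h y" "\<And>y. h y \<le> c" for h
  proof (rule Bochner_Integration.integrable_bound)
    show "integrable L (\<lambda>y. c * f y)" using assms by simp
    show "AE y in L. norm (h y * f y) \<le> norm (c * f y)"
      using that c_nonneg by (auto simp: abs_mult intro!: mult_right_mono)
  qed measurable
  then show "integrable L (\<lambda>y. \<tau> (x, y) * f y)" "integrable L (\<lambda>y. \<tau> (y, x) * f y)"
    using assms(2) \<tau>_nonneg \<tau>_le by auto
qed

definition rate :: "'a \<Rightarrow> real" where "rate x = (\<integral>y. \<tau> (x, y) \<partial>L)"

definition op :: "('a \<Rightarrow> real) \<Rightarrow> 'a \<Rightarrow> real" where
  "op f x = (\<integral>y. \<tau> (x, y) * f y \<partial>L) - rate x * f x"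

definition op_adj :: "('a \<Rightarrow> real) \<Rightarrow> 'a \<Rightarrow> real" where
  "op_adj g y = (\<integral>x. \<tau> (x, y) * g x \<partial>L) - rate y * g y"

lemma measurable_rate [measurable]: "rate \<in> borel_measurable L"
  unfolding rate_def by measurable

lemma rate_bound: "AE x in L. \<bar>rate x\<bar> \<le> c * measure L \<Omega>"
proof (rule AE_I2)
  fix x assume "x \<in> space L"
  then have x: "x \<in> \<Omega>" by simp
  have "rate x \<le> (\<integral>y. c \<partial>L)"
    unfolding rate_def using integrable_\<tau>_mult(1)[of "\<lambda>_. 1" x] x
    by (intro integral_mono) (auto simp: \<tau>_le)
  moreover have "0 \<le> rate x" by (simp add: rate_def \<tau>_nonneg)
  ultimately show "\<bar>rate x\<bar> \<le> c * measure L \<Omega>" by (simp add: mult.commute)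
qed

text \<open>On a domain of finite measure, a uniform bound by the integral of
  \<open>\<bar>f\<bar>\<close> makes both integral parts square-integrable. It also supplies the
  absolute integrability for Fubini in \<open>op_adjoint\<close>.\<close>

lemma inflow_bound:
  assumes "integrable L f" "x \<in> \<Omega>"
  shows "\<bar>\<integral>y. \<tau> (x, y) * f y \<partial>L\<bar> \<le> c * (\<integral>y. \<bar>f y\<bar> \<partial>L)" "\<bar>\<integral>y. \<tau> (y, x) * f y \<partial>L\<bar> \<le> c * (\<integral>y. \<bar>f y\<bar> \<partial>L)"
proof -
  have "\<bar>\<integral>y. h y * f y \<partial>L\<bar> \<le> c * (\<integral>y. \<bar>f y\<bar> \<partial>L)"
    if "integrable L (\<lambda>y. h y * f y)" and "\<And>y. 0 \<le> h y" "\<And>y. h y \<le> c" for h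
  proof -
    have "\<bar>\<integral>y. h y * f y \<partial>L\<bar> \<le> (\<integral>y. \<bar>h y * f y\<bar> \<partial>L)" by (rule integral_abs_bound)
    also have "\<dots> \<le> (\<integral>y. c * \<bar>f y\<bar> \<partial>L)"
    proof (rule integral_mono)
      show "integrable L (\<lambda>y. \<bar>h y * f y\<bar>)" using that by simp
      show "integrable L (\<lambda>y. c * \<bar>f y\<bar>)" using assms by simp
    qed (use that in \<open>auto simp: abs_mult intro: mult_right_mono\<close>)
    finally show ?thesis by simp
  qed
  then show "\<bar>\<integral>y. \<tau> (x, y) * f y \<partial>L\<bar> \<le> c * (\<integral>y. \<bar>f y\<bar> \<partial>L)" "\<bar>\<integral>y. \<tau> (y, x) * f y \<partial>L\<bar> \<le> c * (\<integral>y. \<bar>f y\<bar> \<partial>L)"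
    using integrable_\<tau>_mult[OF assms] \<tau>_nonneg \<tau>_le by auto
qed

lemma L2_op:
  assumes f: "f \<in> L2 \<Omega>"
  shows "(\<lambda>x. \<integral>y. \<tau> (x, y) * f y \<partial>L) \<in> L2 \<Omega>" "(\<lambda>x. \<integral>y. \<tau> (y, x) * f y \<partial>L) \<in> L2 \<Omega>"
    "(\<lambda>x. rate x * f x) \<in> L2 \<Omega>" "op f \<in> L2 \<Omega>" "op_adj f \<in> L2 \<Omega>"
proof -
  have [measurable]: "f \<in> borel_measurable L" using f by (simp add: L2_def)
  have [measurable]: "(\<lambda>(x, y). \<tau> (y, x)) \<in> borel_measurable (L \<Otimes>\<^sub>M L)"
    using measurable_pair_swap[OF measurable_pair_\<tau>] by (simp add: case_prod_beta)
  show 1: "(\<lambda>x. \<integral>y. \<tau> (x, y) * f y \<partial>L) \<in> L2 \<Omega>"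
    using inflow_bound[OF L2_integrable[OF f]] by (intro L2_bounded) (auto intro!: AE_I2)
  show 2: "(\<lambda>x. \<integral>y. \<tau> (y, x) * f y \<partial>L) \<in> L2 \<Omega>"
    using inflow_bound[OF L2_integrable[OF f]] by (intro L2_bounded) (auto intro!: AE_I2)
  show 3: "(\<lambda>x. rate x * f x) \<in> L2 \<Omega>"
    by (rule L2_bounded_mult[OF measurable_rate rate_bound f])
  show "op f \<in> L2 \<Omega>" "op_adj f \<in> L2 \<Omega>"
    unfolding op_def op_adj_def using L2_diff[OF 1 3] L2_diff[OF 2 3] .
qed

text \<open>Fubini exchanges the variables in the integral part; the other part, multiplication by
  the rate, is symmetric.\<close>

lemma op_adjoint:
  assumes f: "f \<in> L2 \<Omega>" and g: "g \<in> L2 \<Omega>"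
  shows "L2_inner \<Omega> (op f) g = L2_inner \<Omega> f (op_adj g)"
proof -
  have [measurable]: "f \<in> borel_measurable L" "g \<in> borel_measurable L" using f g by (auto simp: L2_def)
  note fi = L2_integrable[OF f] and gi = L2_integrable[OF g]
  have int: "integrable (L \<Otimes>\<^sub>M L) (\<lambda>(x, y). \<tau> (x, y) * f y * g x)"
  proof (rule Fubini_integrable)
    have "integrable L (\<lambda>x. (\<integral>y. \<tau> (x, y) * \<bar>f y\<bar> \<partial>L) * \<bar>g x\<bar>)"
    proof (rule Bochner_Integration.integrable_bound)
      show "integrable L (\<lambda>x. c * (\<integral>y. \<bar>f y\<bar> \<partial>L) * g x)" using gi by simp
      show "AE x in L. norm ((\<integral>y. \<tau> (x, y) * \<bar>f y\<bar> \<partial>L) * \<bar>g x\<bar>) \<le> norm (c * (\<integral>y. \<bar>f y\<bar> \<partial>L) * g x)"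
      proof (rule AE_I2)
        fix x assume "x \<in> space L"
        then have "\<bar>\<integral>y. \<tau> (x, y) * \<bar>f y\<bar> \<partial>L\<bar> \<le> \<bar>c * (\<integral>y. \<bar>f y\<bar> \<partial>L)\<bar>"
          using inflow_bound(1)[of "\<lambda>y. \<bar>f y\<bar>" x] fi by simp
        then have "\<bar>\<integral>y. \<tau> (x, y) * \<bar>f y\<bar> \<partial>L\<bar> * \<bar>g x\<bar> \<le> \<bar>c * (\<integral>y. \<bar>f y\<bar> \<partial>L)\<bar> * \<bar>g x\<bar>"
          by (rule mult_right_mono) simp
        then show "norm ((\<integral>y. \<tau> (x, y) * \<bar>f y\<bar> \<partial>L) * \<bar>g x\<bar>) \<le> norm (c * (\<integral>y. \<bar>f y\<bar> \<partial>L) * g x)"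
          by (simp only: real_norm_def abs_mult abs_abs)
      qed
    qed measurable
    then show "integrable L (\<lambda>x. \<integral>y. norm (case (x, y) of (x, y) \<Rightarrow> \<tau> (x, y) * f y * g x) \<partial>L)"
      by (simp add: abs_mult \<tau>_nonneg)
    show "AE x in L. integrable L (\<lambda>y. case (x, y) of (x, y) \<Rightarrow> \<tau> (x, y) * f y * g x)"
      using integrable_\<tau>_mult(1)[OF fi] by (auto intro!: AE_I2)
  qed measurable
  have "(\<integral>x. (\<integral>y. \<tau> (x, y) * f y \<partial>L) * g x \<partial>L) = (\<integral>x. \<integral>y. \<tau> (x, y) * f y * g x \<partial>L \<partial>L)"
    by simp
  also have "\<dots> = (\<integral>y. \<integral>x. \<tau> (x, y) * f y * g x \<partial>L \<partial>L)"
    by (rule Fubini_integral[OF int, symmetric])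
  also have "\<dots> = (\<integral>y. \<integral>x. f y * (\<tau> (x, y) * g x) \<partial>L \<partial>L)" by (simp add: ac_simps)
  also have "\<dots> = (\<integral>y. f y * (\<integral>x. \<tau> (x, y) * g x \<partial>L) \<partial>L)" by simp
  finally have "L2_inner \<Omega> (\<lambda>x. \<integral>y. \<tau> (x, y) * f y \<partial>L) g = L2_inner \<Omega> (\<lambda>y. \<integral>x. \<tau> (x, y) * g x \<partial>L) f"
    by (simp add: L2_inner_def mult.commute)
  moreover have "L2_inner \<Omega> (\<lambda>x. rate x * f x) g = L2_inner \<Omega> (\<lambda>x. rate x * g x) f"
    by (simp add: L2_inner_def ac_simps)
  ultimately have "L2_inner \<Omega> (op f) g = L2_inner \<Omega> (op_adj g) f"
    unfolding op_def op_adj_def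
    using L2_inner_diff_left[OF L2_op(1)[OF f] L2_op(3)[OF f] g]
      L2_inner_diff_left[OF L2_op(2)[OF g] L2_op(3)[OF g] f] by simp
  then show ?thesis by (simp add: L2_inner_commute)
qed

end

lemma L2_cong_AE:
  assumes f: "f \<in> L2 \<Omega>" and "\<Omega> \<in> sets lebesgue" and ae: "AE x in lebesgue_on \<Omega>. f x = g x"
  shows "g \<in> L2 \<Omega>"
proof -
  have meas: "f \<in> borel_measurable (lebesgue_on \<Omega>)" using f by (simp add: L2_def)
  then have g: "g \<in> borel_measurable (lebesgue_on \<Omega>)"
    using assms(2) ae by (rule borel_measurable_lebesgue_on_AE)
  have "integrable (lebesgue_on \<Omega>) (\<lambda>x. (f x)\<^sup>2) \<longleftrightarrow> integrable (lebesgue_on \<Omega>) (\<lambda>x. (g x)\<^sup>2)"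
  proof (rule integrable_cong_AE)
    show "AE x in lebesgue_on \<Omega>. (f x)\<^sup>2 = (g x)\<^sup>2" using ae by eventually_elim simp
  qed (use meas g in auto)
  with f g show ?thesis by (simp add: L2_def)
qed

section \<open>From the Borel kernel to the interaction function\<close>

text \<open>\<sigma> is the given representative, about which only almost everywhere statements are
  available; \<tau> is its Borel version, with which the calculations are done.\<close>

locale L2_interaction = L2_kernel_operator \<Omega> \<tau> c
  for \<Omega> :: "'a::euclidean_space set" and \<tau> :: "'a \<times> 'a \<Rightarrow> real" and c :: real +
  fixes \<sigma> :: "'a \<times> 'a \<Rightarrow> real"
  assumes \<sigma>_eq: "AE p in lebesgue_on (\<Omega> \<times> \<Omega>). \<sigma> p = \<tau> p"
begin

abbreviation A where "A \<equiv> interaction_operator \<Omega> \<sigma>"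

lemma \<sigma>_eq_pair: "AE x in L. AE y in L. \<sigma> (x, y) = \<tau> (x, y)"
  using \<sigma>_eq dom_lebesgue(1) dom_lebesgue(1) dom_lebesgue(2) by (rule AE_lebesgue_on_pair)

lemma total_interaction_eq: "AE x in L. total_interaction \<Omega> \<sigma> x = rate x"
  using \<sigma>_eq_pair AE_space
proof eventually_elim
  case (elim x)
  then have "x \<in> \<Omega>" by simp
  have "(\<integral>y. \<tau> (x, y) \<partial>L) = (\<integral>y. \<sigma> (x, y) \<partial>L)"
  proof (rule integral_lebesgue_on_cong_AE[OF measurable_\<tau>2[OF \<open>x \<in> \<Omega>\<close>] dom_lebesgue(1)])
    show "AE y in L. \<tau> (x, y) = \<sigma> (x, y)" using elim(1) by eventually_elim simp
  qed
  then show ?case by (simp add: total_interaction_def rate_def)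
qed

lemma A_eq_op:
  assumes f: "f \<in> L2 \<Omega>"
  shows "AE x in L. A f x = op f x"
  using \<sigma>_eq_pair AE_space
proof eventually_elim
  case (elim x)
  then have x: "x \<in> \<Omega>" by simp
  have [measurable]: "f \<in> borel_measurable L" using f by (simp add: L2_def)
  note fi = integrable_\<tau>_mult(1)[OF L2_integrable[OF f] x] and ci = integrable_\<tau>_mult(1)[of "\<lambda>_. f x" x]
  have "(\<integral>y. \<tau> (x, y) * (f y - f x) \<partial>L) = (\<integral>y. \<sigma> (x, y) * (f y - f x) \<partial>L)"
  proof (rule integral_lebesgue_on_cong_AE[OF _ dom_lebesgue(1)])
    show "(\<lambda>y. \<tau> (x, y) * (f y - f x)) \<in> borel_measurable L"
      using measurable_\<tau>2[OF x] by simp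
    show "AE y in L. \<tau> (x, y) * (f y - f x) = \<sigma> (x, y) * (f y - f x)"
      using elim(1) by eventually_elim simp
  qed
  moreover have "(\<integral>y. \<tau> (x, y) * (f y - f x) \<partial>L) = (\<integral>y. \<tau> (x, y) * f y - \<tau> (x, y) * f x \<partial>L)"
    by (simp add: algebra_simps)
  moreover have "\<dots> = op f x"
    using fi ci x by (simp add: op_def rate_def)
  ultimately show ?case by (simp add: interaction_operator_def)
qed

lemma A_L2: "f \<in> L2 \<Omega> \<Longrightarrow> A f \<in> L2 \<Omega>"
proof (rule L2_cong_AE[OF L2_op(4) dom_lebesgue(1)])
  assume "f \<in> L2 \<Omega>"
  from A_eq_op[OF this] show "AE x in L. op f x = A f x" by eventually_elim simp
qed

lemma L2_inner_A:
  assumes f: "f \<in> L2 \<Omega>" and g: "g \<in> L2 \<Omega>"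
  shows "L2_inner \<Omega> (A f) g = L2_inner \<Omega> f (op_adj g)"
proof -
  have "L2_inner \<Omega> (A f) g = L2_inner \<Omega> (op f) g"
    using A_L2[OF f] _ g A_eq_op[OF f] by (rule L2_inner_cong_AE) (use L2_op(4)[OF f] in \<open>simp add: L2_def\<close>)
  then show ?thesis by (simp add: op_adjoint f g)
qed

text \<open>\<open>op_adj\<close> is a witness for the choice in \<open>L2_adjoint\<close>. Any two
  adjoints agree almost everywhere, as testing with their difference \<open>d\<close> gives
  \<open>d\<close> norm 0.\<close>

lemma L2_adjoint_A:
  assumes g: "g \<in> L2 \<Omega>"
  shows "AE x in L. L2_adjoint \<Omega> A g x = op_adj g x"
proof -
  have "\<exists>T'. \<forall>g\<in>L2 \<Omega>. T' g \<in> L2 \<Omega> \<and> (\<forall>f\<in>L2 \<Omega>. L2_inner \<Omega> (A f) g = L2_inner \<Omega> f (T' g))"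
    using L2_op(5) L2_inner_A by (intro exI[of _ op_adj]) blast
  then have "\<forall>g\<in>L2 \<Omega>. L2_adjoint \<Omega> A g \<in> L2 \<Omega> \<and>
      (\<forall>f\<in>L2 \<Omega>. L2_inner \<Omega> (A f) g = L2_inner \<Omega> f (L2_adjoint \<Omega> A g))"
    unfolding L2_adjoint_def by (rule someI_ex)
  then have adj: "L2_adjoint \<Omega> A g \<in> L2 \<Omega>"
    "\<And>f. f \<in> L2 \<Omega> \<Longrightarrow> L2_inner \<Omega> f (op_adj g) = L2_inner \<Omega> f (L2_adjoint \<Omega> A g)"
    using g by (auto simp: L2_inner_A)
  define d where "d = (\<lambda>x. L2_adjoint \<Omega> A g x - op_adj g x)"
  have d: "d \<in> L2 \<Omega>" unfolding d_def by (intro L2_diff adj(1) L2_op(5) g)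
  have "L2_inner \<Omega> d d = L2_inner \<Omega> (L2_adjoint \<Omega> A g) d - L2_inner \<Omega> (op_adj g) d"
    by (subst (1) d_def) (rule L2_inner_diff_left[OF adj(1) L2_op(5)[OF g] d])
  also have "\<dots> = 0" using adj(2)[OF d] by (simp add: L2_inner_commute[of _ _ d])
  finally have "AE x in L. d x = 0" by (rule L2_inner_self_eq_0[OF d])
  then show ?thesis by (simp add: d_def)
qed

lemma L2_kernel_adjoint_A:
  "v \<in> L2_kernel \<Omega> (L2_adjoint \<Omega> A) \<longleftrightarrow> v \<in> L2 \<Omega> \<and> (AE x in L. op_adj v x = 0)"
proof (cases "v \<in> L2 \<Omega>")
  case True
  have "(AE x in L. L2_adjoint \<Omega> A v x = 0) \<longleftrightarrow> (AE x in L. op_adj v x = 0)"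
    using L2_adjoint_A[OF True] by (rule eventually_cong[OF _ arg_cong[where f = "\<lambda>z. z = 0"]])
  with True show ?thesis by (simp add: L2_kernel_def)
qed (simp add: L2_kernel_def)

text \<open>By Cauchy-Schwarz, differentiability in norm passes to the real function
  \<open>L2_inner \<Omega> (y t) v\<close>. Its derivative is the inner product of
  \<open>y t\<close> with the adjoint applied to \<open>v\<close>, which is 0.\<close>

lemma L2_inner_solution_constant:
  assumes v: "v \<in> L2_kernel \<Omega> (L2_adjoint \<Omega> A)" and sol: "L2_cauchy_solution \<Omega> \<sigma> yin y"
    and t: "0 \<le> t" "0 \<le> t'"
  shows "L2_inner \<Omega> (y t) v = L2_inner \<Omega> (y t') v"
proof (rule constant_on_nonneg_reals[OF _ t])
  fix t :: real assume t: "0 \<le> t"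
  have v2: "v \<in> L2 \<Omega>" and kv: "AE x in L. op_adj v x = 0"
    using v by (auto simp: L2_kernel_adjoint_A)
  have y2: "y s \<in> L2 \<Omega>" if "0 \<le> s" for s using sol that by (simp add: L2_cauchy_solution_def)
  let ?q = "\<lambda>s x. (y s x - y t x) / (s - t) - A (y t) x"
  have lim: "((\<lambda>s. L2_norm \<Omega> (?q s)) \<longlongrightarrow> 0) (at t within {0..})"
    using sol t by (simp add: L2_cauchy_solution_def L2_has_derivative_at_def)
  have "L2_inner \<Omega> (op_adj v) (y t) = L2_inner \<Omega> (\<lambda>_. 0) (y t)"
    using L2_op(5)[OF v2] _ y2[OF t] kv by (rule L2_inner_cong_AE) simp
  then have zero: "L2_inner \<Omega> (A (y t)) v = 0"
    by (simp add: L2_inner_A y2 t v2 L2_inner_commute[of _ "y t"]) (simp add: L2_inner_def)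
  have quot: "(L2_inner \<Omega> (y s) v - L2_inner \<Omega> (y t) v) / (s - t) = L2_inner \<Omega> (?q s) v"
    and q2: "?q s \<in> L2 \<Omega>" if s: "0 \<le> s" "s \<noteq> t" for s
  proof -
    let ?d = "\<lambda>x. (1 / (s - t)) * y s x + (- 1 / (s - t)) * y t x"
    have d: "?d \<in> L2 \<Omega>" by (intro L2_lincomb y2 s t)
    have q: "?q s = (\<lambda>x. ?d x - A (y t) x)" by (simp add: diff_divide_distrib)
    show "?q s \<in> L2 \<Omega>" unfolding q by (intro L2_diff d A_L2 y2 t)
    have "L2_inner \<Omega> (?q s) v = L2_inner \<Omega> ?d v - L2_inner \<Omega> (A (y t)) v"
      unfolding q by (rule L2_inner_diff_left[OF d A_L2[OF y2[OF t]] v2])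
    also have "L2_inner \<Omega> ?d v = (1 / (s - t)) * L2_inner \<Omega> (y s) v + (- 1 / (s - t)) * L2_inner \<Omega> (y t) v"
      by (rule L2_inner_lincomb_left[OF y2[OF s(1)] y2[OF t] v2])
    finally show "(L2_inner \<Omega> (y s) v - L2_inner \<Omega> (y t) v) / (s - t) = L2_inner \<Omega> (?q s) v"
      by (simp add: zero diff_divide_distrib)
  qed
  have "((\<lambda>s. (L2_inner \<Omega> (y s) v - L2_inner \<Omega> (y t) v) / (s - t)) \<longlongrightarrow> 0) (at t within {0..})"
  proof (rule Lim_null_comparison)
    show "\<forall>\<^sub>F s in at t within {0..}.
        norm ((L2_inner \<Omega> (y s) v - L2_inner \<Omega> (y t) v) / (s - t)) \<le> L2_norm \<Omega> (?q s) * L2_norm \<Omega> v"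
    proof -
      have "\<forall>\<^sub>F s in at t within {0..}. s \<in> {0..} \<and> s \<noteq> t"
        by (auto simp: eventually_at_filter)
      then show ?thesis
      proof eventually_elim
        case (elim s)
        then have s: "0 \<le> s" "s \<noteq> t" by auto
        show ?case unfolding quot[OF s] real_norm_def by (rule L2_Cauchy_Schwarz[OF q2[OF s] v2])
      qed
    qed
    show "((\<lambda>s. L2_norm \<Omega> (?q s) * L2_norm \<Omega> v) \<longlongrightarrow> 0) (at t within {0..})"
      using tendsto_mult_left_zero[OF lim] .
  qed
  then show "((\<lambda>t. L2_inner \<Omega> (y t) v) has_real_derivative 0) (at t within {0..})"
    by (simp add: has_field_derivative_iff)
qed

text \<open>Stationary densities live among the integrable functions. As \<open>L2\<close> functions
  on \<Omega> are integrable, uniqueness carries over, and the bound on the stationary density puts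
  it into \<open>L2\<close>.\<close>

theorem normalized_kernel_function_exists_unique:
  assumes "irreducible_kernel L (\<lambda>x y. \<tau> (x, y)) c \<delta>"
  shows "\<exists>v. L2_normalized_kernel_function \<Omega> \<sigma> v \<and>
      (\<forall>w. L2_normalized_kernel_function \<Omega> \<sigma> w \<longrightarrow> (AE x in L. w x = v x))"
proof -
  interpret K: irreducible_kernel L "\<lambda>x y. \<tau> (x, y)" c \<delta> by (rule assms)
  have stat: "K.stationary v \<longleftrightarrow> integrable L v \<and> (AE x in L. op_adj v x = 0)" for v
    by (simp add: K.stationary_def op_adj_def K.out_rate_def rate_def)
  have norm_iff: "L2_normalized_kernel_function \<Omega> \<sigma> v \<longleftrightarrow>
      v \<in> L2 \<Omega> \<and> K.stationary v \<and> (AE x in L. v x > 0) \<and> (\<integral>x. v x \<partial>L) = 1" for v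
    using L2_integrable[of v]
    by (auto simp: L2_normalized_kernel_function_def L2_kernel_adjoint_A stat L2_inner_def L2_one_def)
  obtain v b where v: "K.stationary v" "AE x in L. 0 < v x" "AE x in L. v x \<le> b" "(\<integral>x. v x \<partial>L) = 1"
    using K.stationary_exists by blast
  have "AE x in L. \<bar>v x\<bar> \<le> b" using v(2,3) by eventually_elim simp
  moreover have "v \<in> borel_measurable L"
    using v(1) unfolding stat by (blast intro: borel_measurable_integrable)
  ultimately have "v \<in> L2 \<Omega>" by (intro L2_bounded)
  with v have "L2_normalized_kernel_function \<Omega> \<sigma> v" by (simp add: norm_iff)
  moreover have "AE x in L. w x = v x" if "L2_normalized_kernel_function \<Omega> \<sigma> w" for w
    using that v K.stationary_unique[of w v] by (simp add: norm_iff)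
  ultimately show ?thesis by blast
qed

end

section \<open>Irreducibility from strong connectedness\<close>

lemma ess_support_eq: "ess_support \<Omega> f = {x \<in> \<Omega>. \<not> zero_density {z \<in> \<Omega>. f z \<noteq> 0} x}"
  by (simp add: ess_support_def zero_density_def)

context L2_interaction
begin

lemma open_square: "open (\<Omega> \<times> \<Omega>)"
  by (intro open_Times open_dom)

lemma \<tau>_abs_le: "\<bar>\<tau> p\<bar> \<le> c"
  using \<tau>_nonneg[of p] \<tau>_le[of p] by simp

text \<open>A change on a null set alters no mean over a ball, so the graph of \<sigma> can be read
  off from \<tau>.\<close>

lemma has_lebesgue_value_\<sigma>:
  "has_lebesgue_value (\<Omega> \<times> \<Omega>) \<sigma> p k \<longleftrightarrow> has_lebesgue_value (\<Omega> \<times> \<Omega>) \<tau> p k"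
proof -
  have "(LINT q|lebesgue_on (\<Omega> \<times> \<Omega> \<inter> ball p r). \<bar>\<tau> q - k\<bar>) = (LINT q|lebesgue_on (\<Omega> \<times> \<Omega> \<inter> ball p r). \<bar>\<sigma> q - k\<bar>)" for r
  proof (rule integral_lebesgue_on_cong_AE)
    show S: "\<Omega> \<times> \<Omega> \<inter> ball p r \<in> sets lebesgue"
      using dom_lebesgue(2) by (intro sets.Int) auto
    have "\<tau> \<in> borel_measurable (lebesgue_on (\<Omega> \<times> \<Omega> \<inter> ball p r))"
      using measurable_\<tau> by (intro measurable_restrict_space1 measurable_completion) simp
    then show "(\<lambda>q. \<bar>\<tau> q - k\<bar>) \<in> borel_measurable (lebesgue_on (\<Omega> \<times> \<Omega> \<inter> ball p r))" by simp
    show "AE q in lebesgue_on (\<Omega> \<times> \<Omega> \<inter> ball p r). \<bar>\<tau> q - k\<bar> = \<bar>\<sigma> q - k\<bar>"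
      unfolding AE_lebesgue_on_iff[OF S]
      using \<sigma>_eq[unfolded AE_lebesgue_on_iff[OF dom_lebesgue(2)]] by eventually_elim simp
  qed
  then show ?thesis by (simp add: has_lebesgue_value_def)
qed

lemma lebesgue_value_\<sigma>:
  assumes "p \<in> \<Omega> \<times> \<Omega>" "has_lebesgue_value (\<Omega> \<times> \<Omega>) \<sigma> p k"
  shows "has_lebesgue_value (\<Omega> \<times> \<Omega>) \<tau> p (lebesgue_value (\<Omega> \<times> \<Omega>) \<sigma> p)"
proof -
  have "has_lebesgue_value (\<Omega> \<times> \<Omega>) \<sigma> p (lebesgue_value (\<Omega> \<times> \<Omega>) \<sigma> p)"
    unfolding lebesgue_value_def
  proof (rule theI)
    show "has_lebesgue_value (\<Omega> \<times> \<Omega>) \<sigma> p k" by (rule assms(2))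
    show "k' = k" if "has_lebesgue_value (\<Omega> \<times> \<Omega>) \<sigma> p k'" for k'
      using has_lebesgue_value_unique[OF measurable_\<tau> \<tau>_abs_le open_square assms(1)] that assms(2)
      by (simp add: has_lebesgue_value_\<sigma>)
  qed
  then show ?thesis by (simp add: has_lebesgue_value_\<sigma>)
qed

text \<open>Lebesgue differentiation in the product space, followed by Fubini for the exceptional
  null set.\<close>

lemma AE_lebesgue_points: "AE x in L. x \<in> lebesgue_points \<Omega> \<sigma>"
proof -
  have \<tau>_meas: "\<tau> \<in> borel_measurable (lebesgue_on (\<Omega> \<times> \<Omega>))"
    using measurable_\<tau> by (intro measurable_restrict_space1 measurable_completion) simp
  have "AE p in lebesgue_on (\<Omega> \<times> \<Omega>). has_lebesgue_value (\<Omega> \<times> \<Omega>) \<tau> p (\<tau> p)"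
    by (rule AE_has_lebesgue_value[OF open_square \<tau>_meas, of c]) (simp add: \<tau>_abs_le)
  from AE_lebesgue_on_pair[OF this dom_lebesgue(1) dom_lebesgue(1) dom_lebesgue(2)] AE_space
  show ?thesis
  proof eventually_elim
    case (elim x)
    from elim(1) have "AE y in L. \<exists>k. has_lebesgue_value (\<Omega> \<times> \<Omega>) \<sigma> (x, y) k"
      by eventually_elim (use has_lebesgue_value_\<sigma> in blast)
    then show ?case using elim by (simp add: lebesgue_points_def)
  qed
qed

text \<open>If \<^term>\<open>\<tau>\<close> vanishes on \<open>E \<times> Z\<close>, then \<open>E \<times> Z\<close> has density 0 at each \<open>(x, z)\<close> where
  \<^term>\<open>\<tau>\<close> has a nonzero Lebesgue value. So a point \<open>x\<close> where \<open>E\<close> has positive upper density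
  only interacts, up to null sets, with points of \<open>E\<close>.\<close>

lemma positive_density_propagates:
  assumes E: "E \<in> sets borel" and ae: "AE p in lebesgue. p \<in> E \<times> (\<Omega> - E) \<longrightarrow> \<tau> p = 0"
    and x: "x \<in> lebesgue_points \<Omega> \<sigma>"
    and y: "y \<in> ess_support \<Omega> (\<lambda>z. lebesgue_value (\<Omega> \<times> \<Omega>) \<sigma> (x, z))"
    and zd: "\<not> zero_density E x"
  shows "\<not> zero_density E y"
proof
  assume zdy: "zero_density E y"
  let ?v = "\<lambda>z. lebesgue_value (\<Omega> \<times> \<Omega>) \<sigma> (x, z)"
  define Z where "Z = \<Omega> - E"
  have Z: "Z \<in> sets borel" using E open_dom by (simp add: Z_def)
  have EZ: "E \<times> Z \<in> sets lebesgue"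
    using borel_Times[OF E Z] by simp
  have "x \<in> \<Omega>" and val: "AE z in lebesgue. z \<in> \<Omega> \<longrightarrow> (\<exists>k. has_lebesgue_value (\<Omega> \<times> \<Omega>) \<sigma> (x, z) k)"
    using x dom_lebesgue(1) by (auto simp: lebesgue_points_def AE_lebesgue_on_iff)
  \<comment> \<open>At a point where the complement of \<open>Z\<close> has density 0, the factor
    \<open>Z\<close> can be cancelled from the density of \<open>E \<times> Z\<close> at
    \<open>(x, z)\<close>, leaving that of \<open>E\<close> at \<open>x\<close>.\<close>
  have "AE z in lebesgue. z \<in> Z \<longrightarrow> zero_density (- Z) z"
    using Z by (intro AE_zero_density_compl) simp
  with val have "AE z in lebesgue. z \<in> \<Omega> \<longrightarrow> ?v z \<noteq> 0 \<longrightarrow> z \<in> E"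
  proof eventually_elim
    case (elim z)
    show ?case
    proof (intro impI, rule ccontr)
      assume z: "z \<in> \<Omega>" "?v z \<noteq> 0" "z \<notin> E"
      then have "(x, z) \<in> \<Omega> \<times> \<Omega>" using \<open>x \<in> \<Omega>\<close> by simp
      moreover from this have "has_lebesgue_value (\<Omega> \<times> \<Omega>) \<tau> (x, z) (?v z)"
        using elim(1) z(1) lebesgue_value_\<sigma> by blast
      ultimately have "zero_density (E \<times> Z) (x, z)"
        using z(2) EZ ae zero_density_at_nonzero_value[OF measurable_\<tau> \<tau>_abs_le open_square]
        unfolding Z_def by blast
      moreover have "zero_density (- Z) z" using elim(2) z by (simp add: Z_def)
      ultimately show False using zd zero_density_Times_imp[OF E Z] by blast
    qed
  qed
  then obtain N where N: "N \<in> null_sets lebesgue" "{z. \<not> (z \<in> \<Omega> \<longrightarrow> ?v z \<noteq> 0 \<longrightarrow> z \<in> E)} \<subseteq> N"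
    by (auto simp: eventually_ae_filter)
  have "zero_density {z \<in> \<Omega>. ?v z \<noteq> 0} y"
  proof (rule zero_density_mono[OF zdy])
    show "negligible N" using N(1) by (simp add: negligible_iff_null_sets)
    show "{z \<in> \<Omega>. ?v z \<noteq> 0} \<subseteq> E \<union> N" using N(2) by blast
  qed (use E in simp)
  with y show False by (simp add: ess_support_eq)
qed

text \<open>If \<open>E\<close> and \<open>\<Omega> - E\<close> both had positive measure, each
  would contain a vertex at which its complement has density 0. A path from the first vertex to the
  second would carry positive upper density of \<open>E\<close> to a point where \<open>E\<close>
  has density 0.\<close>

lemma irreducible_borel:
  assumes conn: "strongly_connected (lebesgue_points \<Omega> \<sigma>)
       (\<lambda>x y. y \<in> ess_support \<Omega> (\<lambda>z. lebesgue_value (\<Omega> \<times> \<Omega>) \<sigma> (x, z)))"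
    and E: "E \<in> sets borel" and ae: "AE p in lebesgue. p \<in> E \<times> (\<Omega> - E) \<longrightarrow> \<tau> p = 0"
  shows "(AE x in L. x \<in> E) \<or> (AE x in L. x \<notin> E)"
proof (rule ccontr)
  assume contr: "\<not> ?thesis"
  have witness: "\<exists>x\<in>lebesgue_points \<Omega> \<sigma>. x \<in> B \<and> zero_density (- B) x"
    if B: "B \<in> sets borel" and notae: "\<not> (AE x in L. x \<notin> B)" for B
  proof (rule ccontr)
    assume none: "\<not> ?thesis"
    have "AE x in L. x \<in> B \<longrightarrow> zero_density (- B) x"
      unfolding AE_lebesgue_on_iff[OF dom_lebesgue(1)]
    proof -
      have "AE x in lebesgue. x \<in> B \<longrightarrow> zero_density (- B) x"
        using B by (intro AE_zero_density_compl) simp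
      then show "AE x in lebesgue. x \<in> \<Omega> \<longrightarrow> x \<in> B \<longrightarrow> zero_density (- B) x"
        by eventually_elim blast
    qed
    with AE_lebesgue_points have "AE x in L. x \<notin> B"
      by eventually_elim (use none in blast)
    with notae show False ..
  qed
  obtain x where x: "x \<in> lebesgue_points \<Omega> \<sigma>" "zero_density (- E) x"
    using witness[OF E] contr by blast
  have "\<not> (AE x in L. x \<notin> \<Omega> - E)"
  proof
    assume "AE x in L. x \<notin> \<Omega> - E"
    then have "AE x in L. x \<in> E" using AE_space by eventually_elim simp
    with contr show False by blast
  qed
  then obtain y where y: "y \<in> lebesgue_points \<Omega> \<sigma>" "zero_density (- (\<Omega> - E)) y"
    using witness[of "\<Omega> - E"] E open_dom by auto
  \<comment> \<open>\<open>E\<close> lies in the complement of \<open>\<Omega> - E\<close>, which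
    has density 0 at \<open>y\<close>.\<close>
  have "zero_density E y"
    by (rule zero_density_mono[OF y(2) _ negligible_empty]) (use E open_dom in auto)
  moreover have "\<not> zero_density E x"
    using x(2) not_zero_density_both[of E x] E by auto
  ultimately show False
    using strongly_connected_propagate[OF conn x(1) y(1), of "\<lambda>x. \<not> zero_density E x"]
      positive_density_propagates[OF E ae] by blast
qed

lemma irreducible_kernel_of_graph:
  assumes conn: "interaction_graph_strongly_connected \<Omega> \<sigma>" and "emeasure lebesgue \<Omega> \<noteq> 0"
  shows "\<exists>\<delta>. irreducible_kernel L (\<lambda>x y. \<tau> (x, y)) c \<delta>"
proof -
  have "0 < ess_inf L (total_interaction \<Omega> \<sigma>)"
    using conn by (simp add: interaction_graph_strongly_connected_def)
  then obtain \<epsilon> where "0 < \<epsilon>" and \<epsilon>: "AE x in L. \<epsilon> \<le> ereal (total_interaction \<Omega> \<sigma> x)"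
    unfolding ess_inf_def less_Sup_iff by blast
  \<comment> \<open>The bound \<epsilon> is an extended real and may be infinite; the kernel locale
    asks for a real one.\<close>
  obtain \<delta> where \<delta>: "0 < \<delta>" "ereal \<delta> < \<epsilon>"
    using ereal_dense2[OF \<open>0 < \<epsilon>\<close>] by auto
  have "irreducible_kernel L (\<lambda>x y. \<tau> (x, y)) c \<delta>"
  proof
    show "(\<lambda>(x, y). \<tau> (x, y)) \<in> borel_measurable (L \<Otimes>\<^sub>M L)" by (rule measurable_pair_\<tau>)
    show "0 \<le> \<tau> (x, y)" "\<tau> (x, y) \<le> c" for x y by (rule \<tau>_nonneg, rule \<tau>_le)
    show "0 < \<delta>" by (rule \<delta>)
    show "AE x in L. \<delta> \<le> (\<integral>y. \<tau> (x, y) \<partial>L)"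
      using \<epsilon> total_interaction_eq
    proof eventually_elim
      case (elim x)
      from less_le_trans[OF \<delta>(2) elim(1)] elim(2) have "\<delta> < rate x" by simp
      then show ?case by (simp add: rate_def)
    qed
    show "emeasure L (space L) \<noteq> 0"
      using assms(2) dom_lebesgue(1) by (simp add: emeasure_restrict_space)
    fix E assume E: "E \<in> sets L" and ae: "AE x in L. AE y in L. x \<in> E \<longrightarrow> y \<notin> E \<longrightarrow> \<tau> (x, y) = 0"
    have "E \<in> sets lebesgue"
      using E dom_lebesgue(1) by (auto simp: sets_restrict_space_iff)
    \<comment> \<open>\<open>E\<close> is only Lebesgue measurable; its Borel part \<open>S\<close>
      differs from it by a null set and can be used in product sets.\<close>
    then obtain S N N' where S: "E = S \<union> N" "N \<subseteq> N'" "N' \<in> null_sets lborel" "S \<in> sets lborel"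
      by (rule sets_completionE)
    have SE: "AE x in L. x \<in> E \<longleftrightarrow> x \<in> S"
    proof -
      have "AE x in lborel. x \<notin> N'" using S(3) by (rule AE_not_in)
      then have "AE x in lebesgue. x \<notin> N'" by (rule AE_completion)
      then show ?thesis
        unfolding AE_lebesgue_on_iff[OF dom_lebesgue(1)] by eventually_elim (use S in auto)
    qed
    have "AE x in L. AE y in L. (x, y) \<in> S \<times> (\<Omega> - S) \<longrightarrow> \<tau> (x, y) = 0"
      using ae SE
    proof eventually_elim
      case (elim x)
      from elim(1) SE show ?case by eventually_elim (use elim(2) in auto)
    qed
    then have "AE x in lebesgue. AE y in lebesgue. (x, y) \<in> (\<Omega> \<inter> S) \<times> (\<Omega> - S) \<longrightarrow> \<tau> (x, y) = 0"
      unfolding AE_lebesgue_on_iff[OF dom_lebesgue(1)]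
    proof eventually_elim
      case (elim x)
      show ?case
      proof (cases "x \<in> \<Omega>")
        case True
        then have "AE y in lebesgue. y \<in> \<Omega> \<longrightarrow> (x, y) \<in> S \<times> (\<Omega> - S) \<longrightarrow> \<tau> (x, y) = 0" using elim by blast
        then show ?thesis by eventually_elim auto
      qed simp
    qed
    then have "AE x in lborel. AE y in lborel. (x, y) \<in> (\<Omega> \<inter> S) \<times> (\<Omega> - S) \<longrightarrow> \<tau> (x, y) = 0"
      by (simp only: AE_completion_iff)
    moreover have T: "\<Omega> \<inter> S \<in> sets borel" "\<Omega> - S \<in> sets borel"
      using S(4) open_dom by auto
    \<comment> \<open>Going back from an iterated to a joint almost everywhere statement requires
      this set to be measurable for the product measure; that is where \<open>S\<close> and \<tau>
      being Borel enters.\<close>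
    have "{p \<in> space (lborel \<Otimes>\<^sub>M lborel). p \<in> (\<Omega> \<inter> S) \<times> (\<Omega> - S) \<longrightarrow> \<tau> p = 0} \<in> sets (lborel \<Otimes>\<^sub>M lborel)"
    proof -
      have "{p \<in> space (lborel \<Otimes>\<^sub>M lborel). p \<in> (\<Omega> \<inter> S) \<times> (\<Omega> - S) \<longrightarrow> \<tau> p = 0}
          = - ((\<Omega> \<inter> S) \<times> (\<Omega> - S)) \<union> \<tau> -` {0}"
        by (auto simp: space_pair_measure)
      moreover have "\<dots> \<in> sets borel"
        using borel_Times[OF T] measurable_sets_borel[OF measurable_\<tau>, of "{0}"] by auto
      ultimately show ?thesis by (simp only: lborel_prod sets_lborel)
    qed
    ultimately have "AE p in lborel \<Otimes>\<^sub>M lborel. p \<in> (\<Omega> \<inter> S) \<times> (\<Omega> - S) \<longrightarrow> \<tau> p = 0"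
      by (intro lborel_pair.AE_pair_measure)
    then have "AE p in lebesgue. p \<in> (\<Omega> \<inter> S) \<times> (\<Omega> - (\<Omega> \<inter> S)) \<longrightarrow> \<tau> p = 0"
      by (subst (asm) lborel_prod) (simp add: AE_completion_iff Diff_Int)
    from irreducible_borel[OF conn[unfolded interaction_graph_strongly_connected_def, THEN conjunct1] T(1) this]
    show "(AE x in L. x \<in> E) \<or> (AE x in L. x \<notin> E)"
    proof
      assume "AE x in L. x \<in> \<Omega> \<inter> S"
      with SE have "AE x in L. x \<in> E" by eventually_elim simp
      then show ?thesis ..
    next
      assume "AE x in L. x \<notin> \<Omega> \<inter> S"
      with SE AE_space have "AE x in L. x \<notin> E" by eventually_elim auto
      then show ?thesis ..
    qed
  qed
  then show ?thesis ..
qed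

end

section \<open>The matrix case and the case of square-integrable functions together\<close>

theorem theorem1:
  fixes s :: "real^'n^'n"
    and \<Omega> :: "'a::euclidean_space set"
    and \<sigma> :: "'a \<times> 'a \<Rightarrow> real"
  shows
    "((\<forall>i j. s $ i $ j \<ge> 0) \<and> matrix_graph_strongly_connected s \<longrightarrow>
        (\<exists>!v. normalized_kernel_vector s v) \<and>
        (\<forall>v. normalized_kernel_vector s v \<longrightarrow>
          (\<forall>yin y. cauchy_solution s yin y \<longrightarrow>
            (\<forall>t\<ge>0. \<forall>t'\<ge>0. weighted_mean v (y t) = weighted_mean v (y t')))))
     \<and>
     (open \<Omega> \<and> bounded \<Omega> \<and> measure lebesgue \<Omega> = 1 \<and>
      interaction_function \<Omega> \<sigma> \<and> interaction_graph_strongly_connected \<Omega> \<sigma> \<longrightarrow>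
        (\<exists>v. L2_normalized_kernel_function \<Omega> \<sigma> v \<and>
          (\<forall>w. L2_normalized_kernel_function \<Omega> \<sigma> w \<longrightarrow> (AE x in lebesgue_on \<Omega>. w x = v x))) \<and>
        (\<forall>v. L2_normalized_kernel_function \<Omega> \<sigma> v \<longrightarrow>
          (\<forall>yin\<in>L2 \<Omega>. \<forall>y. L2_cauchy_solution \<Omega> \<sigma> yin y \<longrightarrow>
            (\<forall>t\<ge>0. \<forall>t'\<ge>0. L2_weighted_mean \<Omega> v (y t) = L2_weighted_mean \<Omega> v (y t')))))"
    (is "(?fin \<longrightarrow> ?fin_ex \<and> ?fin_mean) \<and> (?inf \<longrightarrow> ?inf_ex \<and> ?inf_mean)")
proof (intro conjI impI)
  assume ?fin
  then show ?fin_ex by (intro matrix_normalized_kernel_vector) auto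
next
  show ?fin_mean
    unfolding normalized_kernel_vector_def using matrix_weighted_mean_constant by blast
next
  assume inf: ?inf
  then obtain \<tau> c where \<tau>: "\<tau> \<in> borel_measurable borel" "\<And>p. 0 \<le> \<tau> p" "\<And>p. \<tau> p \<le> c"
    "AE p in lebesgue_on (\<Omega> \<times> \<Omega>). \<sigma> p = \<tau> p"
    using interaction_function_borel_representative[of \<Omega> \<sigma>] by blast
  interpret L2_interaction \<Omega> \<tau> c \<sigma>
    using inf \<tau> by unfold_locales auto
  have "emeasure lebesgue \<Omega> \<noteq> 0" using inf by (auto simp: measure_def)
  then obtain \<delta> where "irreducible_kernel L (\<lambda>x y. \<tau> (x, y)) c \<delta>"
    using irreducible_kernel_of_graph inf by blast
  then show ?inf_ex by (rule normalized_kernel_function_exists_unique)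
next
  assume inf: ?inf
  then obtain \<tau> c where \<tau>: "\<tau> \<in> borel_measurable borel" "\<And>p. 0 \<le> \<tau> p" "\<And>p. \<tau> p \<le> c"
    "AE p in lebesgue_on (\<Omega> \<times> \<Omega>). \<sigma> p = \<tau> p"
    using interaction_function_borel_representative[of \<Omega> \<sigma>] by blast
  interpret L2_interaction \<Omega> \<tau> c \<sigma>
    using inf \<tau> by unfold_locales auto
  show ?inf_mean
    unfolding L2_normalized_kernel_function_def L2_weighted_mean_def
    using L2_inner_solution_constant by metis
qed

end
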